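(* Let $n\ge 2$, let $\sigma_1,\ldots,\sigma_n$ be weights on $\mathbb{R}^d$, let $K:\mathcal{D}\to[0,\infty)$ be a map, and let $\mathcal{S}\subset\mathcal{D}$ be an $\eta$-sparse family, where $0<\eta<1$. Let $1<p_1,\ldots,p_n<\infty$ with $\frac1{p_1}+\cdots+\frac1{p_n}\ge 1$. Then there is a finite constant $c$, independent of the functions $f_1,\dots,f_n$, of $K$, and of $\mathcal{S}$ (except through $\eta$), such that for all nonnegative functions $f_1,\ldots,f_n\in L^1_{\rm loc}(dx)$ the multilinear embedding inequality $$\sum_{S\in\mathcal{S}}K(S)\prod_{i=1}^n\int_S f_i\,d\sigma_i\le c\,A_0\prod_{i=1}^n\|f_i\|_{L^{p_i}(\sigma_i)}$$ holds in each of the following two cases. (a) $\sigma_1,\ldots,\sigma_n\in A_\infty$ and $$A_0=\sup_{S\in\mathcal{S}}K(S)|S|^{n-1/p_1-\cdots-1/p_n}\prod_{i=1}^n\left(\frac{\sigma_i(S)}{|S|}\right)^{1/p_i'}<\infty.$$ (b) For some $\theta>1$ (the constant $c$ may depend on $\theta$), $$A_0=\sup_{S\in\mathcal{S}}K(S)|S|^{n-1/p_1-\cdots-1/p_n}\prod_{i=1}^n\left(\frac{\sigma_i^{\theta}(S)}{|S|}\right)^{\frac1{\theta p_i'}}<\infty.$$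
   Context: $\mathcal{D}=\{2^{-k}(m+[0,1)^d):k\in\mathbb{Z},m\in\mathbb{Z}^d\}$ is the family of dyadic cubes in $\mathbb{R}^d$. For $0<\eta<1$, a family $\mathcal{S}\subset\mathcal{D}$ is $\eta$-sparse if for every $S\in\mathcal{S}$ there is a measurable set $E_{\mathcal{S}}(S)\subset S$ with $|E_{\mathcal{S}}(S)|\ge\eta|S|$, and the sets $\{E_{\mathcal{S}}(S):S\in\mathcal{S}\}$ are pairwise disjoint; $|E|$ denotes Lebesgue measure. A weight is a nonnegative locally integrable function $\sigma$ on $\mathbb{R}^d$; $d\sigma=\sigma\,dx$, $\sigma(S)=\int_S\sigma\,dx$, $\sigma^\theta(S)=\int_S\sigma^\theta\,dx$, $\|f\|_{L^p(\sigma)}=(\int_{\mathbb{R}^d}|f|^p\sigma\,dx)^{1/p}$. The conjugate exponent is $p'=p/(p-1)$. For $1<p<\infty$, $$[w]_{A_p}=\sup_{Q}\left(\frac1{|Q|}\int_Q w\,dx\right)\left(\frac1{|Q|}\int_Q w^{-\frac1{p-1}}\,dx\right)^{p-1},$$ the supremum being over all cubes $Q\subset\mathbb{R}^d$ with sides parallel to the axes, and $w\in A_\infty$ means $[w]_{A_\infty}:=\lim_{p\to\infty}[w]_{A_p}<\infty$ (in particular $w\in A_p$ for some $1<p<\infty$). The usual convention $0\cdot\infty=0$ is used. *)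

theory Defs
  imports "HOL-Analysis.Analysis"
begin

text \<open>Nonnegative functions are integrated with values in \<^typ>\<open>ennreal\<close>, where
  \<open>0 * \<infinity> = 0\<close> holds; \<open>|E|\<close> is Lebesgue measure on \<open>real ^ 'd\<close>.\<close>

definition dyadic_cube :: "int \<Rightarrow> int ^ 'd \<Rightarrow> (real ^ 'd) set" where
  "dyadic_cube k m = {x. \<forall>i. 2 powi (-k) * real_of_int (m $ i) \<le> x $ i
                            \<and> x $ i < 2 powi (-k) * (real_of_int (m $ i) + 1)}"

definition dyadic_cubes :: "(real ^ 'd) set set" where
  "dyadic_cubes = {dyadic_cube k m | k m. True}"

definition sparse_family :: "real \<Rightarrow> (real ^ 'd) set set \<Rightarrow> bool" where
  "sparse_family \<eta> \<S> \<longleftrightarrow> \<S> \<subseteq> dyadic_cubes \<and>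
     (\<exists>E. (\<forall>S\<in>\<S>. E S \<in> sets lebesgue \<and> E S \<subseteq> S \<and>
                   measure lebesgue (E S) \<ge> \<eta> * measure lebesgue S) \<and>
          disjoint_family_on E \<S>)"

definition locally_integrable :: "(real ^ 'd \<Rightarrow> real) \<Rightarrow> bool" where
  "locally_integrable f \<longleftrightarrow> (\<forall>C. compact C \<longrightarrow> f absolutely_integrable_on C)"

definition weight :: "(real ^ 'd \<Rightarrow> real) \<Rightarrow> bool" where
  "weight \<sigma> \<longleftrightarrow> (\<forall>x. 0 \<le> \<sigma> x) \<and> locally_integrable \<sigma>"

definition conj_exponent :: "real \<Rightarrow> real" where
  "conj_exponent p = p / (p - 1)"

text \<open>Real powers on \<open>[0,\<infinity>]\<close>. Unlike \<^const>\<open>powr\<close> on the reals, which sends \<open>0\<close> to \<open>0\<close> for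
  every exponent, negative powers of \<open>0\<close> are \<open>\<infinity>\<close>; this matters in the dual average of \<open>A\<^sub>p\<close>.\<close>

definition epowr :: "ennreal \<Rightarrow> real \<Rightarrow> ennreal" where
  "epowr x a =
     (if a = 0 then 1
      else if x = 0 then (if a < 0 then \<infinity> else 0)
      else if x = \<infinity> then (if a < 0 then 0 else \<infinity>)
      else ennreal (enn2real x powr a))"

definition wmass :: "(real ^ 'd \<Rightarrow> real) \<Rightarrow> (real ^ 'd) set \<Rightarrow> ennreal" where
  "wmass \<sigma> S = (\<integral>\<^sup>+x\<in>S. ennreal (\<sigma> x) \<partial>lebesgue)"

definition wintegral :: "(real ^ 'd \<Rightarrow> real) \<Rightarrow> (real ^ 'd) set \<Rightarrow> (real ^ 'd \<Rightarrow> real) \<Rightarrow> ennreal" where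
  "wintegral \<sigma> S f = (\<integral>\<^sup>+x\<in>S. ennreal (f x * \<sigma> x) \<partial>lebesgue)"

definition wLp_norm :: "real \<Rightarrow> (real ^ 'd \<Rightarrow> real) \<Rightarrow> (real ^ 'd \<Rightarrow> real) \<Rightarrow> ennreal" where
  "wLp_norm p \<sigma> f = epowr (\<integral>\<^sup>+x. ennreal (\<bar>f x\<bar> powr p * \<sigma> x) \<partial>lebesgue) (1 / p)"

definition axis_cubes :: "(real ^ 'd) set set" where
  "axis_cubes = {cbox a (\<chi> i. a $ i + l) | a l. 0 < l}"

definition average :: "(real ^ 'd) set \<Rightarrow> (real ^ 'd \<Rightarrow> ennreal) \<Rightarrow> ennreal" where
  "average Q g = (\<integral>\<^sup>+x\<in>Q. g x \<partial>lebesgue) / emeasure lebesgue Q"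

definition Ap_const :: "real \<Rightarrow> (real ^ 'd \<Rightarrow> real) \<Rightarrow> ennreal" where
  "Ap_const p w =
     (SUP Q\<in>axis_cubes. average Q (\<lambda>x. ennreal (w x)) *
        epowr (average Q (\<lambda>x. epowr (ennreal (w x)) (- 1 / (p - 1)))) (p - 1))"

text \<open>The limit exists, since \<open>p \<mapsto> Ap_const p w\<close> is nonincreasing on \<open>(1,\<infinity>)\<close> by Jensen's inequality.\<close>

definition Ainf_const :: "(real ^ 'd \<Rightarrow> real) \<Rightarrow> ennreal" where
  "Ainf_const w = Lim at_top (\<lambda>p. Ap_const p w)"

definition A_infinity :: "(real ^ 'd \<Rightarrow> real) set" where
  "A_infinity = {w. weight w \<and> Ainf_const w < \<infinity>}"

definition testing_const ::
  "nat \<Rightarrow> (nat \<Rightarrow> real) \<Rightarrow> (nat \<Rightarrow> real ^ 'd \<Rightarrow> real) \<Rightarrow> ((real ^ 'd) set \<Rightarrow> real) \<Rightarrow> (real ^ 'd) set set \<Rightarrow> ennreal"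
  where
  "testing_const n p \<sigma> K \<S> =
     (SUP S\<in>\<S>. ennreal (K S) * ennreal (measure lebesgue S powr (real n - (\<Sum>i=1..n. 1 / p i))) *
        (\<Prod>i=1..n. epowr (wmass (\<sigma> i) S / emeasure lebesgue S) (1 / conj_exponent (p i))))"

definition bumped_testing_const ::
  "real \<Rightarrow> nat \<Rightarrow> (nat \<Rightarrow> real) \<Rightarrow> (nat \<Rightarrow> real ^ 'd \<Rightarrow> real) \<Rightarrow> ((real ^ 'd) set \<Rightarrow> real) \<Rightarrow> (real ^ 'd) set set \<Rightarrow> ennreal"
  where
  "bumped_testing_const \<theta> n p \<sigma> K \<S> =
     (SUP S\<in>\<S>. ennreal (K S) * ennreal (measure lebesgue S powr (real n - (\<Sum>i=1..n. 1 / p i))) *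
        (\<Prod>i=1..n. epowr (wmass (\<lambda>x. \<sigma> i x powr \<theta>) S / emeasure lebesgue S)
                          (1 / (\<theta> * conj_exponent (p i)))))"

definition multilinear_embedding ::
  "nat \<Rightarrow> (nat \<Rightarrow> real) \<Rightarrow> (nat \<Rightarrow> real ^ 'd \<Rightarrow> real) \<Rightarrow> ((real ^ 'd) set \<Rightarrow> real) \<Rightarrow> (real ^ 'd) set set \<Rightarrow> ennreal \<Rightarrow> bool"
  where
  "multilinear_embedding n p \<sigma> K \<S> C \<longleftrightarrow>
     (\<forall>f. (\<forall>i\<in>{1..n}. (\<forall>x. 0 \<le> f i x) \<and> locally_integrable (f i)) \<longrightarrow>
        (\<Sum>\<^sub>\<infinity>S\<in>\<S>. ennreal (K S) * (\<Prod>i=1..n. wintegral (\<sigma> i) S (f i)))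
          \<le> C * (\<Prod>i=1..n. wLp_norm (p i) (\<sigma> i) (f i)))"

end

theory Submission
  imports Defs
begin

text \<open>It suffices to bound the sum over finite subfamilies \<open>F\<close> of \<open>\<S>\<close>. For each index \<open>i\<close> one
  factors \<open>\<integral>\<^sub>S f\<^sub>i d\<sigma>\<^sub>i\<close> as \<open>|S|\<close> to the power \<open>1 / p\<^sub>i'\<close>, times the \<open>i\<close>-th factor of the testing constant,
  times a number \<open>a\<^sub>i(S)\<close>. The testing constant comes out of the sum, and since
  \<open>\<Sum> 1 / p\<^sub>i \<ge> 1\<close> a discrete Hoelder inequality reduces the claim to bounding the sum over \<open>S\<close> of
  the \<open>p\<^sub>i\<close>-th powers of \<open>a\<^sub>i(S)\<close> by the \<open>p\<^sub>i\<close>-th power of the norm of \<open>f\<^sub>i\<close>. In case (a) these powers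
  are \<open>\<sigma>\<^sub>i(S)\<close> times the \<open>p\<^sub>i\<close>-th power of the \<open>\<sigma>\<^sub>i\<close>-average of \<open>f\<^sub>i\<close>, and the \<open>A\<^sub>\<infinity>\<close> condition turns
  sparseness for Lebesgue measure into sparseness for \<open>\<sigma>\<^sub>i\<close>; in case (b) they are \<open>|S|\<close> times the
  \<open>r\<close>-th power, with \<open>r > 1\<close>, of an unweighted average. Both follow from the \<open>L\<^sup>r\<close> bound for the
  maximal function of a laminar family with respect to an arbitrary measure.\<close>

subsection \<open>Powers in \<open>[0, \<infinity>]\<close> and Hoelder inequalities\<close>

lemma epowr_ennreal: "epowr (ennreal x) a = ennreal (x powr a)" if "0 < x"
  using that by (auto simp: epowr_def ennreal_eq_0_iff)

lemma epowr_ennreal': "epowr (ennreal x) a = ennreal (x powr a)" if "0 \<le> x" "0 < a"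
  using that by (auto simp: epowr_def ennreal_eq_0_iff)

lemma epowr_zero [simp]: "0 < a \<Longrightarrow> epowr 0 a = 0"
  and epowr_top [simp]: "0 < a \<Longrightarrow> epowr top a = top"
  by (auto simp: epowr_def)

lemma epowr_eq_0_iff: "0 < a \<Longrightarrow> epowr x a = 0 \<longleftrightarrow> x = 0"
  by (cases x) (auto simp: epowr_ennreal' ennreal_eq_0_iff)

lemma epowr_eq_top_iff: "0 < a \<Longrightarrow> epowr x a = top \<longleftrightarrow> x = top"
  by (cases x) (auto simp: epowr_ennreal')

text \<open>The convention \<open>0 * top = 0\<close> is compatible with positive exponents. At
  \<open>x = 0\<close>, \<open>y = top\<close> with \<open>a < 0\<close> the left side would be
  infinite and the right side zero.\<close>

lemma epowr_mult: "epowr (x * y) a = epowr x a * epowr y a" if "0 < a"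
proof (cases x; cases y)
  fix r s assume "0 \<le> r" "x = ennreal r" "0 \<le> s" "y = ennreal s"
  then show ?thesis using that
    by (simp add: epowr_ennreal' powr_mult flip: ennreal_mult)
qed (use that in \<open>auto simp: epowr_ennreal' ennreal_mult_top ennreal_top_mult ennreal_eq_0_iff\<close>)

lemma epowr_mono: "epowr x a \<le> epowr y a" if "0 < a" "x \<le> y"
proof (cases x; cases y)
  fix r s assume "0 \<le> r" "x = ennreal r" "0 \<le> s" "y = ennreal s"
  then show ?thesis using that
    by (simp add: epowr_ennreal' powr_mono2)
qed (use that in \<open>auto simp: epowr_ennreal' top_unique\<close>)

lemma epowr_epowr: "0 < a \<Longrightarrow> 0 < b \<Longrightarrow> epowr (epowr x a) b = epowr x (a * b)"
  by (cases x) (auto simp: epowr_ennreal' powr_powr)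

text \<open>Normalise both integrals to 1 and integrate the pointwise bound
  \<open>u powr a * v powr b \<le> a * u + b * v\<close>. Integrals equal to 0 or \<open>top\<close>
  cannot be normalised and are treated first.\<close>

lemma nn_integral_Holder:
  fixes f g :: "'a \<Rightarrow> real"
  assumes [measurable]: "f \<in> borel_measurable M" "g \<in> borel_measurable M"
    and nonneg: "\<And>x. 0 \<le> f x" "\<And>x. 0 \<le> g x"
    and exps: "0 < a" "0 < b" "a + b = 1"
  shows "(\<integral>\<^sup>+x. ennreal (f x powr a * g x powr b) \<partial>M)
         \<le> epowr (\<integral>\<^sup>+x. ennreal (f x) \<partial>M) a * epowr (\<integral>\<^sup>+x. ennreal (g x) \<partial>M) b" (is "?L \<le> ?R")
proof -
  consider "(\<integral>\<^sup>+x. f x \<partial>M) = 0 \<or> (\<integral>\<^sup>+x. g x \<partial>M) = 0"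
    | "(\<integral>\<^sup>+x. f x \<partial>M) \<noteq> 0" "(\<integral>\<^sup>+x. g x \<partial>M) \<noteq> 0" "(\<integral>\<^sup>+x. f x \<partial>M) = top \<or> (\<integral>\<^sup>+x. g x \<partial>M) = top"
    | "(\<integral>\<^sup>+x. f x \<partial>M) \<noteq> 0" "(\<integral>\<^sup>+x. g x \<partial>M) \<noteq> 0" "(\<integral>\<^sup>+x. f x \<partial>M) \<noteq> top" "(\<integral>\<^sup>+x. g x \<partial>M) \<noteq> top"
    by blast
  then show ?thesis
  proof cases
    \<comment> \<open>The right-hand side may be \<open>0 * top = 0\<close> here, so the left-hand
      side has to vanish too: one of the two factors is zero almost everywhere.\<close>
    case 1
    then have "AE x in M. ennreal (f x powr a * g x powr b) = 0"
    proof
      assume "(\<integral>\<^sup>+x. f x \<partial>M) = 0"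
      then have "AE x in M. f x \<le> 0" by (simp add: nn_integral_0_iff_AE ennreal_eq_0_iff)
      then show ?thesis by eventually_elim (use nonneg in \<open>simp add: order_antisym\<close>)
    next
      assume "(\<integral>\<^sup>+x. g x \<partial>M) = 0"
      then have "AE x in M. g x \<le> 0" by (simp add: nn_integral_0_iff_AE ennreal_eq_0_iff)
      then show ?thesis by eventually_elim (use nonneg in \<open>simp add: order_antisym\<close>)
    qed
    then have "?L = 0"
      by (simp add: nn_integral_0_iff_AE)
    then show ?thesis by simp
  next
    case 2
    then have "?R = top"
      using exps by (auto simp: epowr_eq_0_iff ennreal_mult_eq_top_iff)
    then show ?thesis by simp
  next
    case 3
    obtain A B where A: "(\<integral>\<^sup>+x. f x \<partial>M) = ennreal A" "0 < A" and B: "(\<integral>\<^sup>+x. g x \<partial>M) = ennreal B" "0 < B"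
      using 3 by (metis ennreal_cases ennreal_eq_0_iff not_le top_neq_ennreal linorder_not_less)
    have young: "ennreal (f x powr a * g x powr b)
        \<le> ennreal (A powr a * B powr b) * (ennreal (a / A) * ennreal (f x) + ennreal (b / B) * ennreal (g x))" for x
    proof -
      have "(f x / A) powr a * (g x / B) powr b \<le> a * (f x / A) + b * (g x / B)"
      proof (cases "f x = 0 \<or> g x = 0")
        case True
        then show ?thesis using nonneg[of x] A B exps by auto
      next
        case False
        then show ?thesis using nonneg[of x] A B exps
          by (intro Youngs_inequality_0) auto
      qed
      then have "A powr a * B powr b * ((f x / A) powr a * (g x / B) powr b)
          \<le> A powr a * B powr b * (a * (f x / A) + b * (g x / B))"
        by (rule mult_left_mono) simp
      moreover have "A powr a * B powr b * ((f x / A) powr a * (g x / B) powr b) = f x powr a * g x powr b"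
        using A B nonneg[of x] by (simp add: powr_divide field_simps)
      ultimately have "f x powr a * g x powr b \<le> A powr a * B powr b * (a / A * f x + b / B * g x)"
        by simp
      moreover have "ennreal (A powr a * B powr b) * (ennreal (a / A) * ennreal (f x) + ennreal (b / B) * ennreal (g x))
        = ennreal (A powr a * B powr b * (a / A * f x + b / B * g x))"
        using A B nonneg[of x] exps by (simp flip: ennreal_mult ennreal_plus)
      ultimately show ?thesis by (simp add: ennreal_leI)
    qed
    have "?L \<le> (\<integral>\<^sup>+x. ennreal (A powr a * B powr b) * (ennreal (a / A) * ennreal (f x) + ennreal (b / B) * ennreal (g x)) \<partial>M)"
      by (intro nn_integral_mono young)
    also have "\<dots> = ennreal (A powr a * B powr b) * (ennreal (a / A) * ennreal A + ennreal (b / B) * ennreal B)"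
      by (subst nn_integral_cmult, measurable, subst nn_integral_add, measurable)
         (simp add: nn_integral_cmult A B)
    also have "ennreal (a / A) * ennreal A + ennreal (b / B) * ennreal B = 1"
      using A B exps by (simp flip: ennreal_mult ennreal_plus)
    finally show ?thesis
      using A B by (simp add: epowr_ennreal ennreal_mult)
  qed
qed

section \<open>Discrete Hoelder inequality for products of several families\<close>

lemma weighted_AM_GM:
  fixes y t :: "'i \<Rightarrow> real"
  assumes "finite I" "I \<noteq> {}" "\<And>i. i \<in> I \<Longrightarrow> 0 < t i" "sum t I = 1" "\<And>i. i \<in> I \<Longrightarrow> 0 \<le> y i"
  shows "(\<Prod>i\<in>I. y i powr t i) \<le> (\<Sum>i\<in>I. t i * y i)"
proof (cases "\<exists>i\<in>I. y i = 0")
  case True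
  then have "(\<Prod>i\<in>I. y i powr t i) = 0"
    using assms(1) by (auto intro!: prod_zero)
  moreover have "0 \<le> (\<Sum>i\<in>I. t i * y i)"
    using assms(3,5) by (intro sum_nonneg mult_nonneg_nonneg) (auto simp: less_imp_le)
  ultimately show ?thesis by simp
next
  case False
  then have pos: "i \<in> I \<Longrightarrow> 0 < y i" for i using assms(5)[of i] by fastforce
  have "(\<Prod>i\<in>I. y i powr t i) = exp (\<Sum>i\<in>I. t i * ln (y i))"
    unfolding exp_sum[OF assms(1)]
  proof (rule prod.cong)
    show "y i powr t i = exp (t i * ln (y i))" if "i \<in> I" for i
      using pos[OF that] by (simp add: powr_def)
  qed simp
  also have "\<dots> \<le> (\<Sum>i\<in>I. t i * exp (ln (y i)))"
    using convex_on_sum[OF assms(1,2) exp_convex assms(4), of "\<lambda>i. ln (y i)"] assms(3)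
    by (auto simp: less_imp_le)
  also have "\<dots> = (\<Sum>i\<in>I. t i * y i)"
    using pos by (intro sum.cong) auto
  finally show ?thesis .
qed

text \<open>The hypothesis \<open>\<Sum> 1 / p i \<ge> 1\<close> enters here: lowering the exponents of numbers in
  \<open>[0, 1]\<close> only increases their product.\<close>

lemma sum_prod_Holder_real:
  fixes a :: "'i \<Rightarrow> 'b \<Rightarrow> real"
  assumes "finite I" "\<And>i. i \<in> I \<Longrightarrow> 1 < p i" "1 \<le> (\<Sum>i\<in>I. 1 / p i)" "finite F"
    and nonneg: "\<And>i S. i \<in> I \<Longrightarrow> S \<in> F \<Longrightarrow> 0 \<le> a i S"
    and pos: "\<And>i. i \<in> I \<Longrightarrow> 0 < (\<Sum>S\<in>F. a i S powr p i)"
  shows "(\<Sum>S\<in>F. \<Prod>i\<in>I. a i S) \<le> (\<Prod>i\<in>I. (\<Sum>S\<in>F. a i S powr p i) powr (1 / p i))"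
proof -
  define B where "B i = (\<Sum>S\<in>F. a i S powr p i)" for i
  define b where "b i S = a i S powr p i / B i" for i S
  \<comment> \<open>The exponents \<open>1 / (p i * s)\<close> add up to 1 and are at most
    \<open>1 / p i\<close>. The normalised terms \<open>b i S\<close> lie in \<open>[0, 1]\<close>,
    so passing to these exponents enlarges the product and makes the weighted inequality of the
    means applicable.\<close>
  define s where "s = (\<Sum>i\<in>I. 1 / p i)"
  have I: "I \<noteq> {}" using assms(3) by auto
  have s: "1 \<le> s" using assms(3) by (simp add: s_def)
  have Bpos: "i \<in> I \<Longrightarrow> 0 < B i" for i using pos by (simp add: B_def)
  have b0: "0 \<le> b i S" if "i \<in> I" for i S
    using Bpos[OF that] by (simp add: b_def)
  have bsum: "(\<Sum>S\<in>F. b i S) = 1" if "i \<in> I" for i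
    using Bpos[OF that] by (simp add: b_def B_def flip: sum_divide_distrib)
  have b1: "b i S \<le> 1" if "i \<in> I" "S \<in> F" for i S
    using member_le_sum[of S F "b i"] that b0 bsum assms(4) by auto
  have "(\<Prod>i\<in>I. a i S) \<le> (\<Prod>i\<in>I. B i powr (1 / p i)) * (\<Sum>i\<in>I. 1 / (p i * s) * b i S)" if S: "S \<in> F" for S
  proof -
    have "(\<Prod>i\<in>I. a i S) = (\<Prod>i\<in>I. B i powr (1 / p i)) * (\<Prod>i\<in>I. b i S powr (1 / p i))"
      unfolding prod.distrib[symmetric]
    proof (intro prod.cong refl)
      fix i assume i: "i \<in> I"
      show "a i S = B i powr (1 / p i) * b i S powr (1 / p i)"
        using Bpos[OF i] assms(2)[OF i] nonneg[OF i S]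
        by (simp add: b_def powr_divide powr_powr)
    qed
    also have "(\<Prod>i\<in>I. b i S powr (1 / p i)) \<le> (\<Prod>i\<in>I. b i S powr (1 / (p i * s)))"
    proof (intro prod_mono conjI)
      fix i assume i: "i \<in> I"
      have "1 / (p i * s) \<le> 1 / p i"
        using assms(2)[OF i] s by (simp add: field_simps)
      then show "b i S powr (1 / p i) \<le> b i S powr (1 / (p i * s))"
        using b0[OF i] b1[OF i S] by (simp add: powr_mono')
    qed auto
    also have "\<dots> \<le> (\<Sum>i\<in>I. 1 / (p i * s) * b i S)"
    proof (rule weighted_AM_GM)
      show "(\<Sum>i\<in>I. 1 / (p i * s)) = 1"
        using s by (simp add: s_def flip: divide_divide_eq_left sum_divide_distrib)
      show "0 < 1 / (p i * s)" if "i \<in> I" for i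
        using assms(2)[OF that] s by simp
    qed (use assms(1) I b0 in auto)
    finally show ?thesis by (simp add: mult_left_mono prod_nonneg)
  qed
  then have "(\<Sum>S\<in>F. \<Prod>i\<in>I. a i S) \<le> (\<Sum>S\<in>F. (\<Prod>i\<in>I. B i powr (1 / p i)) * (\<Sum>i\<in>I. 1 / (p i * s) * b i S))"
    by (rule sum_mono)
  also have "\<dots> = (\<Prod>i\<in>I. B i powr (1 / p i)) * (\<Sum>i\<in>I. 1 / (p i * s) * (\<Sum>S\<in>F. b i S))"
    by (simp add: sum_distrib_left sum.swap[of _ F])
  also have "(\<Sum>i\<in>I. 1 / (p i * s) * (\<Sum>S\<in>F. b i S)) = 1"
    using s bsum by (simp add: s_def flip: divide_divide_eq_left sum_divide_distrib)
  finally show ?thesis by (simp add: B_def)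
qed

text \<open>If one of the sums is 0, every product on the left contains a zero factor; if none is 0
  and one is infinite, the right side is infinite. Otherwise all entries are finite and the real
  version applies.\<close>

lemma sum_prod_Holder:
  fixes a :: "'i \<Rightarrow> 'b \<Rightarrow> ennreal"
  assumes "finite I" "\<And>i. i \<in> I \<Longrightarrow> 1 < p i" "1 \<le> (\<Sum>i\<in>I. 1 / p i)" "finite F"
  shows "(\<Sum>S\<in>F. \<Prod>i\<in>I. a i S) \<le> (\<Prod>i\<in>I. epowr (\<Sum>S\<in>F. epowr (a i S) (p i)) (1 / p i))"
proof -
  have p0: "0 < p i" "0 < 1 / p i" if "i \<in> I" for i using assms(2)[OF that] by auto
  consider (zero) i where "i \<in> I" "(\<Sum>S\<in>F. epowr (a i S) (p i)) = 0"
    | (top) j where "\<And>i. i \<in> I \<Longrightarrow> (\<Sum>S\<in>F. epowr (a i S) (p i)) \<noteq> 0" "j \<in> I" "(\<Sum>S\<in>F. epowr (a j S) (p j)) = top"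
    | (fin) "\<And>i. i \<in> I \<Longrightarrow> (\<Sum>S\<in>F. epowr (a i S) (p i)) \<noteq> 0" "\<And>i. i \<in> I \<Longrightarrow> (\<Sum>S\<in>F. epowr (a i S) (p i)) \<noteq> top"
    by blast
  then show ?thesis
  proof cases
    case zero
    then have "a i S = 0" if "S \<in> F" for S
      using that p0 assms(4) by (simp add: sum_eq_0_iff epowr_eq_0_iff)
    then have "(\<Sum>S\<in>F. \<Prod>i\<in>I. a i S) = 0"
      using zero assms(1) by (intro sum.neutral ballI prod_zero) auto
    then show ?thesis by simp
  next
    case top
    then have "(\<Prod>i\<in>I. epowr (\<Sum>S\<in>F. epowr (a i S) (p i)) (1 / p i)) = top"
      using assms(1) p0 by (auto simp: ennreal_prod_eq_top epowr_eq_0_iff epowr_eq_top_iff)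
    then show ?thesis by simp
  next
    case fin
    define r where "r i S = enn2real (a i S)" for i S
    have r: "a i S = ennreal (r i S)" "0 \<le> r i S" if "i \<in> I" "S \<in> F" for i S
    proof -
      have "epowr (a i S) (p i) \<noteq> top"
        using fin(2)[OF that(1)] that assms(4) by (auto simp: ennreal_sum_eq_top)
      then show "a i S = ennreal (r i S)" "0 \<le> r i S"
        using p0[OF that(1)] by (auto simp: r_def epowr_eq_top_iff less_top)
    qed
    have s: "(\<Sum>S\<in>F. epowr (a i S) (p i)) = ennreal (\<Sum>S\<in>F. r i S powr p i)" if "i \<in> I" for i
      using r that p0[OF that] by (simp add: epowr_ennreal')
    have pos: "0 < (\<Sum>S\<in>F. r i S powr p i)" if "i \<in> I" for i
      using fin(1)[OF that] s[OF that] by (simp add: ennreal_eq_0_iff not_le)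
    have "(\<Sum>S\<in>F. \<Prod>i\<in>I. a i S) = ennreal (\<Sum>S\<in>F. \<Prod>i\<in>I. r i S)"
      using r by (simp add: prod_ennreal prod_nonneg)
    also have "\<dots> \<le> ennreal (\<Prod>i\<in>I. (\<Sum>S\<in>F. r i S powr p i) powr (1 / p i))"
      by (intro ennreal_leI sum_prod_Holder_real assms r pos)
    also have "\<dots> = (\<Prod>i\<in>I. epowr (\<Sum>S\<in>F. epowr (a i S) (p i)) (1 / p i))"
      using s pos by (simp add: epowr_ennreal prod_ennreal)
    finally show ?thesis .
  qed
qed

subsection \<open>The maximal function of a laminar family\<close>

text \<open>Behind this is the bound \<open>r * t powr (r - 1) \<le> r * b * t powr (r - 2)\<close>
  for \<open>0 < t \<le> b\<close>, integrated from \<open>a\<close> to \<open>b\<close>. The proof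
  gets it algebraically from Young's inequality. It controls one insertion step for the maximal
  function.\<close>

lemma diff_powr_le:
  fixes a b r :: real
  assumes "0 \<le> a" "a \<le> b" "1 < r"
  shows "b powr r - a powr r \<le> r / (r - 1) * b * (b powr (r - 1) - a powr (r - 1))"
proof (cases "a = 0 \<or> b = 0")
  case True
  then show ?thesis
  proof
    assume "a = 0"
    have "b powr r = b * b powr (r - 1)"
      using assms \<open>a = 0\<close> by (cases "b = 0") (auto simp: powr_mult_base)
    moreover have "1 * (b * b powr (r - 1)) \<le> r / (r - 1) * (b * b powr (r - 1))"
      using assms by (intro mult_right_mono) auto
    ultimately show ?thesis using \<open>a = 0\<close> assms by simp
  qed (use assms in auto)
next
  case False
  then have ab: "0 < a" "0 < b" using assms by auto
  have young: "(a powr r) powr ((r - 1) / r) * (b powr r) powr (1 / r) \<le> (r - 1) / r * a powr r + 1 / r * b powr r"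
    using assms ab by (intro Youngs_inequality_0) (auto simp: field_simps)
  have "a powr (r - 1) * b \<le> (r - 1) / r * a powr r + 1 / r * b powr r"
    using young assms ab by (simp add: powr_powr)
  then have "r / (r - 1) * (a powr (r - 1) * b) \<le> r / (r - 1) * ((r - 1) / r * a powr r + 1 / r * b powr r)"
    using assms by (intro mult_left_mono) auto
  also have "\<dots> = a powr r + 1 / (r - 1) * b powr r"
    using assms by (simp add: field_simps)
  \<comment> \<open>Writing \<open>1 / (r - 1)\<close> as \<open>r / (r - 1) - 1\<close> isolates
    the term \<open>b powr r\<close> that is to be bounded.\<close>
  also have "\<dots> = a powr r + (r / (r - 1) - 1) * b powr r"
    using assms by (simp add: field_simps)
  finally have "r / (r - 1) * (a powr (r - 1) * b) \<le> a powr r + (r / (r - 1) - 1) * b powr r" .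
  moreover have "b powr r = b * b powr (r - 1)"
    using ab by (simp add: powr_mult_base)
  ultimately show ?thesis by (simp add: algebra_simps)
qed

text \<open>The added 0 keeps the set nonempty and is the value outside the union of the family. The
  numbers \<open>A S\<close> are left arbitrary; in the applications they are averages over
  \<open>S\<close>.\<close>

definition maximal_fun :: "('a set \<Rightarrow> real) \<Rightarrow> 'a set set \<Rightarrow> 'a \<Rightarrow> real" where
  "maximal_fun A F x = Max (insert 0 (A ` {S\<in>F. x \<in> S}))"

lemma maximal_fun_empty [simp]: "maximal_fun A {} x = 0"
  by (simp add: maximal_fun_def)

lemma maximal_fun_nonneg: "finite F \<Longrightarrow> 0 \<le> maximal_fun A F x"
  by (simp add: maximal_fun_def)

lemma maximal_fun_insert:
  assumes "finite F"
  shows "maximal_fun A (insert S F) x = (if x \<in> S then max (A S) (maximal_fun A F x) else maximal_fun A F x)"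
proof -
  have "{T \<in> insert S F. x \<in> T} = (if x \<in> S then insert S {T\<in>F. x \<in> T} else {T\<in>F. x \<in> T})"
    by auto
  then show ?thesis
    using assms by (simp add: maximal_fun_def insert_commute[of 0])
qed

lemma maximal_fun_ge: "finite F \<Longrightarrow> S \<in> F \<Longrightarrow> x \<in> S \<Longrightarrow> A S \<le> maximal_fun A F x"
  by (simp add: maximal_fun_def)

definition laminar :: "'a set set \<Rightarrow> bool" where
  "laminar F \<longleftrightarrow> (\<forall>S\<in>F. \<forall>T\<in>F. S \<subseteq> T \<or> T \<subseteq> S \<or> S \<inter> T = {})"

lemma laminar_subset: "laminar F \<Longrightarrow> G \<subseteq> F \<Longrightarrow> laminar G"
  by (auto simp: laminar_def)

text \<open>Removing a minimal member of a finite laminar family leaves a laminar family. Read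
  upwards, sets are inserted from large to small, and each new set is contained in or disjoint from
  every earlier one.\<close>

lemma laminar_minimal_induct [consumes 2, case_names empty insert]:
  assumes "finite F" "laminar F" "P {}"
    and "\<And>S F. finite F \<Longrightarrow> laminar (insert S F) \<Longrightarrow> S \<notin> F \<Longrightarrow> (\<And>T. T \<in> F \<Longrightarrow> S \<subseteq> T \<or> S \<inter> T = {}) \<Longrightarrow> P F
         \<Longrightarrow> P (insert S F)"
  shows "P F"
  using assms(1,2)
proof (induction rule: finite_psubset_induct)
  case (psubset F)
  show ?case
  proof (cases "F = {}")
    case False
    then obtain S where S: "S \<in> F" "\<And>T. T \<in> F \<Longrightarrow> T \<subseteq> S \<Longrightarrow> T = S"
      using finite_has_minimal[OF psubset.hyps] by blast
    have "P (insert S (F - {S}))"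
    proof (rule assms(4))
      show "laminar (insert S (F - {S}))" using psubset.prems S(1) by (simp add: insert_absorb)
      show "S \<subseteq> T \<or> S \<inter> T = {}" if "T \<in> F - {S}" for T
        using that S psubset.prems unfolding laminar_def by blast
      show "P (F - {S})"
        using S(1) psubset.prems by (intro psubset.IH) (auto intro: laminar_subset)
    qed (use psubset.hyps in auto)
    then show ?thesis using S(1) by (simp add: insert_absorb)
  qed (use assms(3) in simp)
qed

text \<open>A pathwise form of Doob's inequality: inserting a minimal set \<open>S\<close> changes the integrand only
  on \<open>S\<close>, where the maximal function is constant, and there the increment has integral at most
  \<open>0\<close> because \<open>A S\<close> is the average of \<open>h\<close>.\<close>

lemma maximal_function_invariant:
  fixes h :: "'a \<Rightarrow> real"
  assumes "finite F" "laminar F" "1 < r"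
    and "\<And>S. S \<in> F \<Longrightarrow> S \<in> sets M \<and> emeasure M S < \<infinity> \<and> set_integrable M S h
           \<and> 0 \<le> A S \<and> measure M S * A S = (LINT x:S|M. h x)"
  shows "integrable M (\<lambda>x. maximal_fun A F x powr r) \<and>
         integrable M (\<lambda>x. maximal_fun A F x powr r - r / (r - 1) * h x * maximal_fun A F x powr (r - 1)) \<and>
         (LINT x|M. maximal_fun A F x powr r - r / (r - 1) * h x * maximal_fun A F x powr (r - 1)) \<le> 0"
  using assms(1,2,4)
proof (induction rule: laminar_minimal_induct)
  case empty
  then show ?case using assms(3) by simp
next
  case (insert S F)
  define c where "c = r / (r - 1)"
  \<comment> \<open>By minimality all points of \<open>S\<close> lie in the same members of
    \<open>F\<close>, so the old maximal function is constant on \<open>S\<close>. For empty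
    \<open>S\<close> the value 0 is an arbitrary choice.\<close>
  obtain m where m: "0 \<le> m" "\<And>x. x \<in> S \<Longrightarrow> maximal_fun A F x = m"
  proof (cases "S = {}")
    case False
    then obtain z where z: "z \<in> S" by auto
    have "maximal_fun A F x = maximal_fun A F z" if "x \<in> S" for x
    proof -
      have "{T\<in>F. x \<in> T} = {T\<in>F. z \<in> T}" using insert.hyps(4) that z by blast
      then show ?thesis by (simp add: maximal_fun_def)
    qed
    then show ?thesis using that[of "maximal_fun A F z"] maximal_fun_nonneg[OF insert.hyps(1)] by auto
  qed (use that[of 0] in auto)
  define b where "b = max (A S) m"
  have S: "S \<in> sets M" "emeasure M S < \<infinity>" "set_integrable M S h" "0 \<le> A S"
      "measure M S * A S = (LINT x:S|M. h x)"
    using insert.prems[of S] by auto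
  have powr: "maximal_fun A (insert S F) x powr s = maximal_fun A F x powr s + indicator S x * (b powr s - m powr s)" for x s
    using m(2) by (simp add: maximal_fun_insert[OF insert.hyps(1)] b_def indicator_def)
  have iS: "integrable M (indicator S :: 'a \<Rightarrow> real)"
    using S by simp
  have ih: "integrable M (\<lambda>x. indicator S x * h x)"
    using S(3) by (simp add: set_integrable_def)
  have IH: "integrable M (\<lambda>x. maximal_fun A F x powr r)"
      "integrable M (\<lambda>x. maximal_fun A F x powr r - c * h x * maximal_fun A F x powr (r - 1))"
      "(LINT x|M. maximal_fun A F x powr r - c * h x * maximal_fun A F x powr (r - 1)) \<le> 0"
    using insert.IH insert.prems unfolding c_def by auto
  have eq: "(\<lambda>x. maximal_fun A (insert S F) x powr r - c * h x * maximal_fun A (insert S F) x powr (r - 1))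
      = (\<lambda>x. (maximal_fun A F x powr r - c * h x * maximal_fun A F x powr (r - 1)) +
          ((b powr r - m powr r) * indicator S x
           - c * (b powr (r - 1) - m powr (r - 1)) * (indicator S x * h x)))"
    by (simp add: powr fun_eq_iff algebra_simps)
  have int: "integrable M (\<lambda>x. (b powr r - m powr r) * indicator S x
           - c * (b powr (r - 1) - m powr (r - 1)) * (indicator S x * h x))"
    using iS ih by (intro Bochner_Integration.integrable_diff integrable_mult_right)
  have "(LINT x|M. (b powr r - m powr r) * indicator S x
           - c * (b powr (r - 1) - m powr (r - 1)) * (indicator S x * h x))
      = (b powr r - m powr r) * measure M S - c * (b powr (r - 1) - m powr (r - 1)) * (measure M S * A S)"
    using iS ih S by (subst Bochner_Integration.integral_diff) (auto simp: set_lebesgue_integral_def)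
  also have "\<dots> = measure M S * ((b powr r - m powr r) - c * A S * (b powr (r - 1) - m powr (r - 1)))"
    by (simp add: algebra_simps)
  also have "\<dots> \<le> 0"
  proof (rule mult_nonneg_nonpos)
    show "(b powr r - m powr r) - c * A S * (b powr (r - 1) - m powr (r - 1)) \<le> 0"
    \<comment> \<open>If \<open>A S \<le> m\<close> then \<open>b = m\<close> and both differences
      vanish; otherwise \<open>b = A S\<close> and \<open>diff_powr_le\<close> applies.\<close>
    proof (cases "A S \<le> m")
      case False
      then show ?thesis
        using diff_powr_le[OF m(1), of b r] assms(3) by (simp add: b_def c_def)
    qed (simp add: b_def)
  qed simp
  finally have le: "(LINT x|M. (b powr r - m powr r) * indicator S x
           - c * (b powr (r - 1) - m powr (r - 1)) * (indicator S x * h x)) \<le> 0" .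
  have "integrable M (\<lambda>x. maximal_fun A (insert S F) x powr r)"
    unfolding powr using IH(1) iS by (intro Bochner_Integration.integrable_add integrable_mult_left)
  moreover have "integrable M (\<lambda>x. maximal_fun A (insert S F) x powr r - c * h x * maximal_fun A (insert S F) x powr (r - 1))"
    unfolding eq using IH(2) int by (rule Bochner_Integration.integrable_add)
  moreover have "(LINT x|M. maximal_fun A (insert S F) x powr r - c * h x * maximal_fun A (insert S F) x powr (r - 1)) \<le> 0"
    unfolding eq using IH int le by (subst Bochner_Integration.integral_add) auto
  ultimately show ?case unfolding c_def by simp
qed

text \<open>The invariant compares the \<open>r\<close>-th power of the maximal function with a
  mixed term in \<open>h\<close> and the maximal function. Absorbing the mixed term pointwise costs
  the factor 2 in the constant; the integrability contained in the invariant makes the subtraction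
  legitimate.\<close>

lemma Doob_maximal_inequality:
  fixes h :: "'a \<Rightarrow> real"
  assumes F: "finite F" "laminar F" and r: "1 < r" and h: "\<And>x. 0 \<le> h x" "integrable M (\<lambda>x. h x powr r)"
    and S: "\<And>S. S \<in> F \<Longrightarrow> S \<in> sets M \<and> emeasure M S < \<infinity> \<and> set_integrable M S h
           \<and> 0 \<le> A S \<and> measure M S * A S = (LINT x:S|M. h x)"
  shows "integrable M (\<lambda>x. maximal_fun A F x powr r)"
    and "(LINT x|M. maximal_fun A F x powr r) \<le> (2 * (r / (r - 1))) powr r * (LINT x|M. h x powr r)"
proof -
  define c where "c = r / (r - 1)"
  define G where "G x = maximal_fun A F x powr r - c * h x * maximal_fun A F x powr (r - 1)" for x
  have inv: "integrable M (\<lambda>x. maximal_fun A F x powr r)" "integrable M G" "(LINT x|M. G x) \<le> 0"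
    using maximal_function_invariant[OF F r S] unfolding c_def G_def by auto
  have c: "1 < c" using r by (simp add: c_def)
  have "maximal_fun A F x powr r \<le> 2 * G x + (2 * c) powr r * h x powr r" for x
  proof -
    let ?m = "maximal_fun A F x"
    have m: "0 \<le> ?m" using F(1) by (rule maximal_fun_nonneg)
    have eq: "?m powr r = ?m * ?m powr (r - 1)"
      using m by (cases "?m = 0") (auto simp: powr_mult_base)
    have "2 * c * h x * ?m powr (r - 1) \<le> ?m powr r + (2 * c) powr r * h x powr r"
    \<comment> \<open>The larger of \<open>2 * c * h x\<close> and \<open>?m\<close> dominates the
      product, so one of the two \<open>r\<close>-th powers alone bounds it.\<close>
    proof (cases "2 * c * h x \<le> ?m")
      case True
      then have "2 * c * h x * ?m powr (r - 1) \<le> ?m * ?m powr (r - 1)"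
        by (rule mult_right_mono) simp
      then show ?thesis using eq by (simp add: add_increasing2)
    next
      case False
      have "2 * c * h x * ?m powr (r - 1) \<le> 2 * c * h x * (2 * c * h x) powr (r - 1)"
        using False m r h(1)[of x] c by (intro mult_left_mono powr_mono2) auto
      also have "\<dots> = (2 * c * h x) powr r"
        using False m by (simp add: powr_mult_base)
      also have "\<dots> = (2 * c) powr r * h x powr r"
        using c h(1)[of x] by (simp add: powr_mult)
      finally show ?thesis by (simp add: add_increasing)
    qed
    then show ?thesis by (simp add: G_def algebra_simps)
  qed
  then have "(LINT x|M. maximal_fun A F x powr r) \<le> (LINT x|M. 2 * G x + (2 * c) powr r * h x powr r)"
    using inv h by (intro integral_mono) auto
  also have "\<dots> = 2 * (LINT x|M. G x) + (2 * c) powr r * (LINT x|M. h x powr r)"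
    using inv h by simp
  finally show "(LINT x|M. maximal_fun A F x powr r) \<le> (2 * (r / (r - 1))) powr r * (LINT x|M. h x powr r)"
    using inv unfolding c_def by simp
  show "integrable M (\<lambda>x. maximal_fun A F x powr r)" by fact
qed

text \<open>Trading \<open>measure M S\<close> for \<open>measure M (E S)\<close> turns the sum into
  the integral of a function living on disjoint sets, and on \<open>E S\<close> that function is
  below the power of the maximal function. The measure is general because both Lebesgue measure and
  \<open>\<sigma> dx\<close> are used later.\<close>

lemma sparse_embedding:
  fixes h :: "'a \<Rightarrow> real"
  assumes F: "finite F" "laminar F" and r: "1 < r"
    and h: "\<And>x. 0 \<le> h x" "h \<in> borel_measurable M" "integrable M (\<lambda>x. h x powr r)"
    and S: "\<And>S. S \<in> F \<Longrightarrow> S \<in> sets M" "\<And>S. S \<in> F \<Longrightarrow> emeasure M S < \<infinity>"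
    and E: "\<And>S. S \<in> F \<Longrightarrow> E S \<in> sets M" "\<And>S. S \<in> F \<Longrightarrow> E S \<subseteq> S"
      "\<And>S. S \<in> F \<Longrightarrow> measure M S \<le> d * measure M (E S)" "disjoint_family_on E F"
  shows "\<And>S. S \<in> F \<Longrightarrow> set_integrable M S h"
    and "(\<Sum>S\<in>F. measure M S * ((LINT x:S|M. h x) / measure M S) powr r)
         \<le> \<bar>d\<bar> * (2 * (r / (r - 1))) powr r * (LINT x|M. h x powr r)"
proof -
  show int: "set_integrable M S h" if "S \<in> F" for S
    unfolding set_integrable_def
  proof (rule Bochner_Integration.integrable_bound)
    show "integrable M (\<lambda>x. indicator S x + h x powr r)"
      using h S that by (intro Bochner_Integration.integrable_add) auto
    show "(\<lambda>x. indicat_real S x *\<^sub>R h x) \<in> borel_measurable M"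
      using h S that by measurable
    have "indicator S x * h x \<le> indicator S x + h x powr r" for x
    proof (cases "h x \<le> 1")
      case False
      then have "h x powr 1 \<le> h x powr r" using r by (intro powr_mono) auto
      then show ?thesis using False by (simp add: indicator_def)
    qed (simp add: indicator_def add_increasing2)
    then show "AE x in M. norm (indicat_real S x *\<^sub>R h x) \<le> norm (indicator S x + h x powr r)"
      using h(1) by (auto simp: abs_mult)
  qed
  define A where "A S = (LINT x:S|M. h x) / measure M S" for S
  have A0: "0 \<le> A S" for S
    using h(1) by (simp add: A_def set_lebesgue_integral_def)
  have A: "S \<in> sets M \<and> emeasure M S < \<infinity> \<and> set_integrable M S h
           \<and> 0 \<le> A S \<and> measure M S * A S = (LINT x:S|M. h x)" if "S \<in> F" for S
  proof -
    \<comment> \<open>For a null set, division by zero makes \<open>A S\<close> equal to 0, so the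
      identity for the average requires the integral to vanish.\<close>
    have "(LINT x:S|M. h x) = 0" if "measure M S = 0"
    proof -
      have "S \<in> null_sets M"
        using that S[OF \<open>S \<in> F\<close>] by (auto simp: null_sets_def measure_def enn2real_eq_0_iff)
      then have "AE x in M. indicat_real S x *\<^sub>R h x = 0"
        by (auto dest: AE_not_in)
      then show ?thesis
        unfolding set_lebesgue_integral_def by (rule integral_eq_zero_AE)
    qed
    then show ?thesis using S int A0 that by (auto simp: A_def)
  qed
  note doob = Doob_maximal_inequality[OF F r h(1,3) A]
  have fin: "emeasure M (E S) < \<infinity>" if "S \<in> F" for S
    using emeasure_mono[OF E(2) S(1)] S(2) that by (meson le_less_trans)
  \<comment> \<open>The sign of \<open>d\<close> is not prescribed; its absolute value keeps the
    factor nonnegative, so that later inequalities can be multiplied by it.\<close>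
  have "(\<Sum>S\<in>F. measure M S * A S powr r) \<le> (\<Sum>S\<in>F. \<bar>d\<bar> * (measure M (E S) * A S powr r))"
  proof (intro sum_mono)
    fix S assume "S \<in> F"
    then have "measure M S \<le> \<bar>d\<bar> * measure M (E S)"
      using E(3)[of S] by (meson abs_ge_self measure_nonneg mult_right_mono order_trans)
    then show "measure M S * A S powr r \<le> \<bar>d\<bar> * (measure M (E S) * A S powr r)"
      using mult_right_mono[of "measure M S" "\<bar>d\<bar> * measure M (E S)" "A S powr r"] by (simp add: mult.assoc)
  qed
  also have "\<dots> = \<bar>d\<bar> * (LINT x|M. (\<Sum>S\<in>F. indicator (E S) x * A S powr r))"
    using fin E(1) by (subst Bochner_Integration.integral_sum) (auto simp: sum_distrib_left)
  also have "\<dots> \<le> \<bar>d\<bar> * (LINT x|M. maximal_fun A F x powr r)"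
  proof (intro mult_left_mono integral_mono)
    show "integrable M (\<lambda>x. \<Sum>S\<in>F. indicator (E S) x * A S powr r)"
      using fin E(1) by (intro Bochner_Integration.integrable_sum) auto
    fix x
    show "(\<Sum>S\<in>F. indicator (E S) x * A S powr r) \<le> maximal_fun A F x powr r"
    proof (cases "\<exists>S\<in>F. x \<in> E S")
      case True
      then obtain S where S': "S \<in> F" "x \<in> E S" by auto
      \<comment> \<open>Disjointness of the sets \<open>E T\<close> leaves a single nonzero term at
        \<open>x\<close>.\<close>
      have "(\<Sum>T\<in>F. indicator (E T) x * A T powr r) = (\<Sum>T\<in>F. if T = S then A S powr r else 0)"
        using E(4) S' by (intro sum.cong) (auto simp: disjoint_family_on_def indicator_def)
      also have "\<dots> \<le> maximal_fun A F x powr r"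
        using F S' E(2)[of S] A0[of S] r by (auto intro!: powr_mono2 maximal_fun_ge)
      finally show ?thesis .
    qed (auto simp: indicator_def intro!: sum_nonpos)
  qed (use doob in auto)
  also have "\<dots> \<le> \<bar>d\<bar> * ((2 * (r / (r - 1))) powr r * (LINT x|M. h x powr r))"
    using doob(2) by (intro mult_left_mono) auto
  finally show "(\<Sum>S\<in>F. measure M S * ((LINT x:S|M. h x) / measure M S) powr r)
         \<le> \<bar>d\<bar> * (2 * (r / (r - 1))) powr r * (LINT x|M. h x powr r)"
    by (simp add: A_def mult_ac)
qed

subsection \<open>Weights and dyadic cubes\<close>

text \<open>Truncations to closed balls are integrable, hence measurable, and at each point they are
  eventually equal to the function.\<close>

lemma locally_integrable_measurable:
  assumes "locally_integrable f"
  shows "f \<in> borel_measurable lebesgue"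
proof (rule borel_measurable_LIMSEQ_real)
  show "(\<lambda>x. indicat_real (cball 0 (real n)) x *\<^sub>R f x) \<in> borel_measurable lebesgue" for n
    using assms unfolding locally_integrable_def set_integrable_def
    by (intro borel_measurable_integrable) auto
  fix x :: "real ^ 'a"
  obtain N where N: "norm x \<le> real N" using real_arch_simple by blast
  have "\<forall>\<^sub>F n in sequentially. indicat_real (cball 0 (real n)) x *\<^sub>R f x = f x"
    using eventually_ge_at_top[of N]
  proof eventually_elim
    case (elim n)
    then have "norm x \<le> real n" using N by linarith
    then show ?case by simp
  qed
  then show "(\<lambda>n. indicat_real (cball 0 (real n)) x *\<^sub>R f x) \<longlonglongrightarrow> f x"
    by (rule tendsto_eventually)
qed

lemma weight_measurable: "weight \<sigma> \<Longrightarrow> \<sigma> \<in> borel_measurable lebesgue"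
  by (simp add: weight_def locally_integrable_measurable)

lemma wmass_mono: "S \<subseteq> T \<Longrightarrow> wmass \<sigma> S \<le> wmass \<sigma> T"
  unfolding wmass_def by (intro nn_integral_mono) (auto simp: indicator_def)

lemma wmass_finite:
  assumes "weight \<sigma>" "compact Q"
  shows "wmass \<sigma> Q < \<infinity>"
proof -
  have "integrable lebesgue (\<lambda>x. indicat_real Q x *\<^sub>R \<sigma> x)"
    using assms by (simp add: weight_def locally_integrable_def set_integrable_def)
  then have "(\<integral>\<^sup>+x. ennreal (norm (indicat_real Q x *\<^sub>R \<sigma> x)) \<partial>lebesgue) < \<infinity>"
    by (simp add: integrable_iff_bounded)
  also have "(\<integral>\<^sup>+x. ennreal (norm (indicat_real Q x *\<^sub>R \<sigma> x)) \<partial>lebesgue) = wmass \<sigma> Q"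
    unfolding wmass_def using assms(1) by (intro nn_integral_cong) (simp add: weight_def indicator_def)
  finally show ?thesis .
qed

section \<open>Nesting and measure of dyadic cubes\<close>

lemma dyadic_cube_floor:
  "dyadic_cube k m = {x :: real ^ 'd. \<forall>i. \<lfloor>2 powi k * x $ i\<rfloor> = m $ i}"
proof -
  have "2 powi (-k) * real_of_int a \<le> y \<longleftrightarrow> real_of_int a \<le> 2 powi k * y"
      "y < 2 powi (-k) * (real_of_int a + 1) \<longleftrightarrow> 2 powi k * y < real_of_int a + 1" for a y
    by (simp_all add: power_int_minus field_simps)
  then show ?thesis by (simp add: dyadic_cube_def floor_eq_iff)
qed

lemma dyadic_cube_subset:
  assumes "k \<le> k'" "x \<in> dyadic_cube k m" "x \<in> dyadic_cube k' m'"
  shows "dyadic_cube k' m' \<subseteq> dyadic_cube k m"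
proof
  \<comment> \<open>The floor at the coarse scale is the integer quotient of the floor at the fine
    scale by a power of two. Hence the fine cube of a point determines its coarse cube.\<close>
  have div: "\<lfloor>2 powi k * z\<rfloor> = \<lfloor>2 powi k' * z\<rfloor> div 2 ^ nat (k' - k)" for z :: real
  proof -
    have "(2 :: real) powi k' = 2 powi k * 2 powi (k' - k)"
      by (simp flip: power_int_add)
    also have "(2 :: real) powi (k' - k) = real_of_int (2 ^ nat (k' - k))"
      using assms(1) by (simp add: power_int_def)
    finally have "2 powi k * z = (2 powi k' * z) / real_of_int (2 ^ nat (k' - k))"
      by simp
    then show ?thesis
      by (metis floor_divide_real_eq_div zero_le_numeral zero_le_power)
  qed
  fix y assume "y \<in> dyadic_cube k' m'"
  then show "y \<in> dyadic_cube k m"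
    using assms(2,3) by (simp add: dyadic_cube_floor div)
qed

lemma laminar_dyadic: "laminar dyadic_cubes"
  unfolding laminar_def
proof (intro ballI)
  fix S T :: "(real ^ 'd) set"
  assume "S \<in> dyadic_cubes" "T \<in> dyadic_cubes"
  then obtain k m k' m' where S: "S = dyadic_cube k m" and T: "T = dyadic_cube k' m'"
    by (auto simp: dyadic_cubes_def)
  show "S \<subseteq> T \<or> T \<subseteq> S \<or> S \<inter> T = {}"
  proof (cases "S \<inter> T = {}")
    case False
    then show ?thesis
      using dyadic_cube_subset[of k k' _ m m'] dyadic_cube_subset[of k' k _ m' m]
      unfolding S T by (metis disjoint_iff linear)
  qed simp
qed

text \<open>A half-open cube lies between an open and a closed box of the same volume. The closed
  box serves as \<open>Q\<close>: it belongs to \<open>axis_cubes\<close>, and weights are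
  integrable on it by compactness.\<close>

lemma dyadic_cube_obtain:
  fixes S :: "(real ^ 'd) set"
  assumes "S \<in> dyadic_cubes"
  obtains Q where "Q \<in> axis_cubes" "compact Q" "S \<subseteq> Q" "S \<in> sets lebesgue"
    "0 < measure lebesgue S" "emeasure lebesgue S = ennreal (measure lebesgue S)"
    "emeasure lebesgue Q = ennreal (measure lebesgue S)"
proof -
  obtain k and m :: "int ^ 'd" where S: "S = dyadic_cube k m"
    using assms by (auto simp: dyadic_cubes_def)
  define l :: real where "l = 2 powi (-k)"
  have l: "0 < l" by (simp add: l_def)
  define a :: "real ^ 'd" where "a = (\<chi> i. l * real_of_int (m $ i))"
  define b :: "real ^ 'd" where "b = (\<chi> i. a $ i + l)"
  have S_eq: "S = {x. \<forall>i. a $ i \<le> x $ i \<and> x $ i < b $ i}"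
    by (simp add: S dyadic_cube_def a_def b_def l_def algebra_simps)
  have sub: "box a b \<subseteq> S" "S \<subseteq> cbox a b"
    by (auto simp: S_eq mem_box_cart less_imp_le)
  have "S = (\<Inter>i. {x. a $ i \<le> x $ i} \<inter> {x. x $ i < b $ i})"
    by (auto simp: S_eq)
  also have "\<dots> \<in> sets borel"
    by (intro sets.countable_INT'' sets.Int borel_closed borel_open closed_Collect_le open_Collect_less
        continuous_intros) auto
  finally have bor: "S \<in> sets borel" .
  have "a \<in> cbox a b" and le: "\<And>i. i \<in> Basis \<Longrightarrow> a \<bullet> i \<le> b \<bullet> i"
    using l by (auto simp: mem_box_cart b_def Basis_vec_def inner_axis)
  define v where "v = (\<Prod>i\<in>Basis. (b - a) \<bullet> i)"
  have v: "0 < v"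
    unfolding v_def using l by (intro prod_pos) (auto simp: b_def Basis_vec_def inner_axis)
  have "emeasure lborel (box a b) = ennreal v" "emeasure lborel (cbox a b) = ennreal v"
    using le by (simp_all add: emeasure_lborel_box_eq emeasure_lborel_cbox_eq v_def)
  moreover have "emeasure lborel (box a b) \<le> emeasure lborel S" "emeasure lborel S \<le> emeasure lborel (cbox a b)"
    using sub bor by (auto intro!: emeasure_mono)
  ultimately have em: "emeasure lebesgue S = ennreal v" "emeasure lebesgue (cbox a b) = ennreal v"
    using bor by (auto intro: order_antisym)
  then have "measure lebesgue S = v"
    using v by (simp add: measure_def)
  moreover have "cbox a b \<in> axis_cubes"
    using l unfolding axis_cubes_def b_def by auto
  ultimately show ?thesis
    using that[of "cbox a b"] em v sub bor by auto
qed

text \<open>In \<open>ennreal\<close> a finite number divided by \<open>top\<close> is 0, so the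
  finite volume of the cube is what matters.\<close>

lemma divide_dyadic_cube_eq_0_iff:
  assumes "S \<in> dyadic_cubes"
  shows "a / emeasure lebesgue S = 0 \<longleftrightarrow> a = 0"
proof -
  have "emeasure lebesgue S \<noteq> top"
    using dyadic_cube_obtain[OF assms] by (metis ennreal_neq_top)
  then show ?thesis by (simp only: ennreal_divide_eq_0_iff) simp
qed

section \<open>Consequences of the A_infinity condition\<close>

lemma A_infinity_obtain_Ap:
  assumes "\<sigma> \<in> A_infinity"
  obtains p where "1 < p" "Ap_const p \<sigma> < \<infinity>"
proof -
  have "\<exists>p>1. Ap_const p \<sigma> < \<infinity>"
  proof (rule ccontr)
    \<comment> \<open>If every constant with \<open>p > 1\<close> were infinite, the limit defining
      \<open>Ainf_const\<close> would be infinite as well.\<close>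
    assume "\<not> (\<exists>p>1. Ap_const p \<sigma> < \<infinity>)"
    have top: "Ap_const p \<sigma> = \<infinity>" if "1 < p" for p
    proof -
      have "\<not> Ap_const p \<sigma> < \<infinity>" using \<open>\<not> (\<exists>p>1. Ap_const p \<sigma> < \<infinity>)\<close> that by blast
      then show ?thesis by (simp add: not_less top_unique)
    qed
    have "\<forall>\<^sub>F p in at_top. Ap_const p \<sigma> = \<infinity>"
      using eventually_gt_at_top[of 1] by eventually_elim (rule top)
    then have "((\<lambda>p. Ap_const p \<sigma>) \<longlongrightarrow> \<infinity>) at_top"
      by (rule tendsto_eventually)
    then have "Ainf_const \<sigma> = \<infinity>"
      unfolding Ainf_const_def by (intro tendsto_Lim) auto
    then show False using assms by (simp add: A_infinity_def)
  qed
  then show ?thesis using that by auto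
qed

text \<open>The case \<open>wmass \<sigma> S = 0\<close> is separate: there the dual average may be infinite, and \<open>A\<^sub>p\<close>
  gives no information because of \<open>0 * \<infinity> = 0\<close>.\<close>

lemma Ap_wmass_le:
  fixes \<sigma> :: "real ^ 'd \<Rightarrow> real"
  assumes w: "weight \<sigma>" and p: "1 < p" and Ap: "Ap_const p \<sigma> \<le> ennreal A" "0 \<le> A"
    and S: "S \<in> dyadic_cubes" and E: "E \<in> sets lebesgue" "E \<subseteq> S"
    and \<eta>: "0 < \<eta>" "\<eta> * measure lebesgue S \<le> measure lebesgue E"
  shows "wmass \<sigma> S \<le> ennreal (A / \<eta> powr p) * wmass \<sigma> E"
proof (cases "wmass \<sigma> S = 0")
  case nz: False
  note [measurable] = weight_measurable[OF w]
  have \<sigma>0: "0 \<le> \<sigma> x" for x using w by (simp add: weight_def)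
  obtain Q where Q: "Q \<in> axis_cubes" "compact Q" "S \<subseteq> Q" "S \<in> sets lebesgue"
    "0 < measure lebesgue S" "emeasure lebesgue S = ennreal (measure lebesgue S)"
    "emeasure lebesgue Q = ennreal (measure lebesgue S)"
    using dyadic_cube_obtain[OF S] .
  have [measurable]: "Q \<in> sets lebesgue" using Q(2) by (simp add: compact_imp_closed)
  define s where "s = measure lebesgue S"
  define e where "e = measure lebesgue E"
  have s: "0 < s" using Q by (simp add: s_def)
  have se: "\<eta> * s \<le> e" using \<eta> by (simp add: s_def e_def)
  have e: "0 < e" using se s \<eta>(1) by (meson less_le_trans mult_pos_pos)
  have emE: "emeasure lebesgue E = ennreal e"
  proof -
    have "emeasure lebesgue E \<le> emeasure lebesgue S" using E Q by (intro emeasure_mono) auto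
    then have "emeasure lebesgue E \<noteq> \<infinity>" using Q(6) by (auto simp: top_unique)
    then show ?thesis by (simp add: e_def emeasure_eq_ennreal_measure)
  qed
  define V where "V = (\<integral>\<^sup>+x\<in>Q. epowr (ennreal (\<sigma> x)) (- 1 / (p - 1)) \<partial>lebesgue)"
  have Wle: "wmass \<sigma> E \<le> wmass \<sigma> S" "wmass \<sigma> S \<le> wmass \<sigma> Q" "wmass \<sigma> Q < \<infinity>"
    using E(2) Q wmass_finite[OF w Q(2)] by (auto intro: wmass_mono)
  obtain X where X: "wmass \<sigma> S = ennreal X" "0 < X"
    using Wle nz by (metis ennreal_cases ennreal_eq_0_iff infinity_ennreal_def leD not_le top_greatest)
  obtain Y where Y: "wmass \<sigma> E = ennreal Y" "0 \<le> Y"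
    using Wle by (metis ennreal_cases infinity_ennreal_def leD order_trans)
  have "average Q (\<lambda>x. ennreal (\<sigma> x)) * epowr (average Q (\<lambda>x. epowr (ennreal (\<sigma> x)) (- 1 / (p - 1)))) (p - 1)
      \<le> Ap_const p \<sigma>"
    unfolding Ap_const_def using Q(1) by (rule SUP_upper)
  then have "wmass \<sigma> Q / ennreal s * epowr (V / ennreal s) (p - 1) \<le> ennreal A"
    using Ap(1) Q(7) by (simp add: average_def wmass_def V_def s_def)
  \<comment> \<open>Only the mass of \<open>\<sigma>\<close> is restricted to \<open>S\<close>; the
    dual integral \<open>V\<close> stays on \<open>Q\<close>, which has the same volume
    \<open>s\<close>.\<close>
  moreover have "wmass \<sigma> S / ennreal s * epowr (V / ennreal s) (p - 1)
      \<le> wmass \<sigma> Q / ennreal s * epowr (V / ennreal s) (p - 1)"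
    using Wle(2) by (intro mult_right_mono divide_right_mono_ennreal) auto
  ultimately have AX: "ennreal (X / s) * epowr (V / ennreal s) (p - 1) \<le> ennreal A"
    using X s by (simp add: divide_ennreal)
  have Vtop: "V \<noteq> top"
  proof
    assume "V = top"
    then have "ennreal (X / s) * epowr (V / ennreal s) (p - 1) = top"
      using p X s by (simp add: ennreal_top_divide ennreal_mult_top ennreal_eq_0_iff not_le)
    then show False using AX by (simp add: top_unique)
  qed
  then obtain v where v: "V = ennreal v" "0 \<le> v" by (cases V) auto
  have "X / s * (v / s) powr (p - 1) \<le> A"
    using AX v s p X Ap(2) by (simp add: divide_ennreal epowr_ennreal' flip: ennreal_mult)
  then have AX': "X * v powr (p - 1) \<le> A * s powr p"
    using s v powr_mult_base[of s "p - 1"] by (simp add: powr_divide field_simps)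
  have [measurable]: "(\<lambda>x. epowr (ennreal (\<sigma> x)) (- 1 / (p - 1)) * indicator Q x) \<in> borel_measurable lebesgue"
  proof -
    have "epowr (ennreal (\<sigma> x)) (- 1 / (p - 1)) = (if \<sigma> x = 0 then \<infinity> else ennreal (\<sigma> x powr (- 1 / (p - 1))))" for x
      using \<sigma>0[of x] p by (auto simp: epowr_def ennreal_eq_0_iff divide_less_0_iff)
    then show ?thesis by simp
  qed
  have "AE x in lebesgue. epowr (ennreal (\<sigma> x)) (- 1 / (p - 1)) * indicator Q x \<noteq> \<infinity>"
  proof (rule nn_integral_noteq_infinite)
    show "(\<lambda>x. epowr (ennreal (\<sigma> x)) (- 1 / (p - 1)) * indicator Q x) \<in> borel_measurable lebesgue"
      by measurable
  qed (use Vtop in \<open>simp add: V_def\<close>)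
  \<comment> \<open>The integrand of \<open>V\<close> is infinite at the zeros of
    \<open>\<sigma>\<close>, so finiteness of \<open>V\<close> makes \<open>\<sigma>\<close>
    positive almost everywhere on \<open>Q\<close>. From here on real negative powers may be
    used.\<close>
  then have pos: "AE x in lebesgue. x \<in> Q \<longrightarrow> 0 < \<sigma> x"
  proof eventually_elim
    case (elim x)
    then show ?case using \<sigma>0[of x] p by (cases "\<sigma> x = 0") (auto simp: epowr_def)
  qed
  define a where "a = 1 / p"
  have a: "0 < a" "0 < 1 - a" "a * p = 1" "(1 - a) * p = p - 1" "(1 - a) / (p - 1) = a"
    using p by (auto simp: a_def field_simps)
  \<comment> \<open>On \<open>E\<close> the constant 1 is split as \<open>\<sigma> powr a\<close>
    times its reciprocal. Hoelder's inequality then bounds \<open>e powr p\<close> by the mass of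
    \<open>E\<close> times the power \<open>p - 1\<close> of \<open>V\<close>.\<close>
  have "ennreal e = (\<integral>\<^sup>+x\<in>E. 1 \<partial>lebesgue)"
    using E emE by simp
  also have "\<dots> = (\<integral>\<^sup>+x\<in>E. ennreal (\<sigma> x powr a * (\<sigma> x powr (- 1 / (p - 1))) powr (1 - a)) \<partial>lebesgue)"
  proof (rule nn_integral_cong_AE)
    show "AE x in lebesgue. 1 * indicator E x
        = ennreal (\<sigma> x powr a * (\<sigma> x powr (- 1 / (p - 1))) powr (1 - a)) * indicator E x"
      using pos
    proof eventually_elim
      case (elim x)
      show ?case
      proof (cases "x \<in> E")
        case True
        then have "0 < \<sigma> x" using elim E(2) Q(3) by auto
        moreover have "- 1 / (p - 1) * (1 - a) = - a" using a(5) by (simp add: field_simps)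
        ultimately have "\<sigma> x powr a * (\<sigma> x powr (- 1 / (p - 1))) powr (1 - a) = 1"
          unfolding powr_powr by (simp flip: powr_add)
        then show ?thesis using True by simp
      qed simp
    qed
  qed
  also have "\<dots> = (\<integral>\<^sup>+x. ennreal (\<sigma> x powr a * (\<sigma> x powr (- 1 / (p - 1))) powr (1 - a)) \<partial>restrict_space lebesgue E)"
    using E(1) by (subst nn_integral_restrict_space) auto
  also have "\<dots> \<le> epowr (\<integral>\<^sup>+x. ennreal (\<sigma> x) \<partial>restrict_space lebesgue E) a
      * epowr (\<integral>\<^sup>+x. ennreal (\<sigma> x powr (- 1 / (p - 1))) \<partial>restrict_space lebesgue E) (1 - a)"
    using \<sigma>0 a by (intro nn_integral_Holder measurable_restrict_space1) auto
  also have "\<dots> = epowr (wmass \<sigma> E) a * epowr (\<integral>\<^sup>+x\<in>E. ennreal (\<sigma> x powr (- 1 / (p - 1))) \<partial>lebesgue) (1 - a)"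
    using E(1) by (simp add: nn_integral_restrict_space wmass_def)
  also have "(\<integral>\<^sup>+x\<in>E. ennreal (\<sigma> x powr (- 1 / (p - 1))) \<partial>lebesgue) \<le> V"
    unfolding V_def
  proof (rule nn_integral_mono_AE)
    show "AE x in lebesgue. ennreal (\<sigma> x powr (- 1 / (p - 1))) * indicator E x
        \<le> epowr (ennreal (\<sigma> x)) (- 1 / (p - 1)) * indicator Q x"
      using pos
    proof eventually_elim
      case (elim x)
      then show ?case using E(2) Q(3) by (auto simp: indicator_def epowr_ennreal)
    qed
  qed
  finally have "ennreal e \<le> epowr (wmass \<sigma> E) a * epowr V (1 - a)"
    using a by (simp add: epowr_mono mult_left_mono)
  then have "epowr (ennreal e) p \<le> epowr (epowr (wmass \<sigma> E) a * epowr V (1 - a)) p"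
    using p by (intro epowr_mono) auto
  also have "\<dots> = epowr (wmass \<sigma> E) (a * p) * epowr V ((1 - a) * p)"
    using p a(1,2) by (simp only: epowr_mult epowr_epowr)
  also have "\<dots> = wmass \<sigma> E * epowr V (p - 1)"
    using a(3,4) Y by (simp add: epowr_ennreal')
  finally have ep: "e powr p \<le> Y * v powr (p - 1)"
    using e p Y v by (simp add: epowr_ennreal' flip: ennreal_mult)
  \<comment> \<open>Sparseness bounds \<open>e\<close> from below by \<open>\<eta> * s\<close>, and
    \<open>AX'\<close> eliminates the dual factor in \<open>v\<close>; the powers of
    \<open>s\<close> then cancel.\<close>
  have "X * (\<eta> * s) powr p \<le> X * e powr p"
    using se X s \<eta>(1) p by (intro mult_left_mono powr_mono2) auto
  also have "\<dots> \<le> X * (Y * v powr (p - 1))"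
    using ep X by (intro mult_left_mono) auto
  also have "\<dots> = Y * (X * v powr (p - 1))" by simp
  also have "\<dots> \<le> Y * (A * s powr p)"
    using AX' Y by (intro mult_left_mono) auto
  finally have "X * \<eta> powr p * s powr p \<le> Y * A * s powr p"
    using \<eta>(1) s by (simp add: powr_mult mult_ac)
  then have "X * \<eta> powr p \<le> Y * A" using s by simp
  then have "X \<le> A / \<eta> powr p * Y"
    using \<eta>(1) by (simp add: field_simps)
  then show ?thesis
    using X Y Ap(2) by (simp add: ennreal_leI flip: ennreal_mult)
qed simp

subsection \<open>The multilinear embedding\<close>

lemma sparse_family_subset: "sparse_family \<eta> \<S> \<Longrightarrow> F \<subseteq> \<S> \<Longrightarrow> sparse_family \<eta> F"
  unfolding sparse_family_def by (meson disjoint_family_on_mono subset_iff)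

text \<open>\<open>T\<close> is the factor of the testing constant that belongs to one index.\<close>

definition index_bound ::
  "real \<Rightarrow> real \<Rightarrow> (real ^ 'd \<Rightarrow> real) \<Rightarrow> ((real ^ 'd) set \<Rightarrow> ennreal) \<Rightarrow> real \<Rightarrow> bool" where
  "index_bound \<eta> p \<sigma> T C \<longleftrightarrow>
     (\<forall>F f. finite F \<longrightarrow> sparse_family \<eta> F \<longrightarrow> (\<forall>x. 0 \<le> f x) \<longrightarrow> locally_integrable f \<longrightarrow>
       (\<exists>a. (\<forall>S\<in>F. wintegral \<sigma> S f \<le> ennreal (measure lebesgue S powr (1 / conj_exponent p)) * T S * a S) \<and>
            (\<Sum>S\<in>F. epowr (a S) p) \<le> ennreal C * (\<integral>\<^sup>+x. ennreal (\<bar>f x\<bar> powr p * \<sigma> x) \<partial>lebesgue)))"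

text \<open>An infinite norm is settled by the constant choice \<open>a = top\<close>, except where
  \<open>T S = 0\<close> turns the right side into \<open>0 * top = 0\<close>. Assumption
  \<open>zero\<close> covers those cubes, and \<open>fin\<close> handles finite norms.\<close>

lemma index_boundI:
  fixes \<sigma> :: "real ^ 'd \<Rightarrow> real" and T :: "(real ^ 'd) set \<Rightarrow> ennreal"
  assumes C: "0 < C"
    and zero: "\<And>S f. S \<in> dyadic_cubes \<Longrightarrow> (\<And>x. 0 \<le> f x) \<Longrightarrow> locally_integrable f \<Longrightarrow> T S = 0
        \<Longrightarrow> wintegral \<sigma> S f = 0"
    and fin: "\<And>F f. finite F \<Longrightarrow> sparse_family \<eta> F \<Longrightarrow> (\<And>x. 0 \<le> f x) \<Longrightarrow> locally_integrable f
        \<Longrightarrow> (\<integral>\<^sup>+x. ennreal (f x powr p * \<sigma> x) \<partial>lebesgue) \<noteq> top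
        \<Longrightarrow> \<exists>a. (\<forall>S\<in>F. wintegral \<sigma> S f \<le> ennreal (measure lebesgue S powr (1 / conj_exponent p)) * T S * a S) \<and>
            (\<Sum>S\<in>F. epowr (a S) p) \<le> ennreal C * (\<integral>\<^sup>+x. ennreal (f x powr p * \<sigma> x) \<partial>lebesgue)"
  shows "index_bound \<eta> p \<sigma> T C"
  unfolding index_bound_def
proof (intro allI impI)
  fix F :: "(real ^ 'd) set set" and f :: "real ^ 'd \<Rightarrow> real"
  assume F: "finite F" "sparse_family \<eta> F" and f: "\<forall>x. 0 \<le> f x" "locally_integrable f"
  let ?N = "\<integral>\<^sup>+x. ennreal (\<bar>f x\<bar> powr p * \<sigma> x) \<partial>lebesgue"
  show "\<exists>a. (\<forall>S\<in>F. wintegral \<sigma> S f \<le> ennreal (measure lebesgue S powr (1 / conj_exponent p)) * T S * a S) \<and>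
            (\<Sum>S\<in>F. epowr (a S) p) \<le> ennreal C * ?N"
  proof (cases "?N = top")
    case True
    have "wintegral \<sigma> S f \<le> ennreal (measure lebesgue S powr (1 / conj_exponent p)) * T S * top" if "S \<in> F" for S
    proof (cases "T S = 0")
      case False
      have "S \<in> dyadic_cubes" using F(2) that by (auto simp: sparse_family_def)
      then have "0 < measure lebesgue S" using dyadic_cube_obtain by metis
      then show ?thesis using False by (simp add: ennreal_mult_top ennreal_eq_0_iff not_le)
    next
      case True
      then show ?thesis
        using zero[of S f] F(2) f that by (auto simp: sparse_family_def)
    qed
    then show ?thesis
      using True C by (intro exI[of _ "\<lambda>_. top"]) (simp add: ennreal_mult_top ennreal_eq_0_iff not_le)
  qed (use fin[OF F, of f] f in simp)
qed

lemma index_bound_A_infinity: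
  fixes \<sigma> :: "real ^ 'd \<Rightarrow> real"
  assumes A: "\<sigma> \<in> A_infinity" and p: "1 < p" and \<eta>: "0 < \<eta>"
  shows "\<exists>C>0. index_bound \<eta> p \<sigma> (\<lambda>S. epowr (wmass \<sigma> S / emeasure lebesgue S) (1 / conj_exponent p)) C"
proof -
  have w: "weight \<sigma>" using A by (simp add: A_infinity_def)
  note [measurable] = weight_measurable[OF w]
  have \<sigma>0: "0 \<le> \<sigma> x" for x using w by (simp add: weight_def)
  obtain u where u: "1 < u" "Ap_const u \<sigma> < \<infinity>" using A_infinity_obtain_Ap[OF A] .
  then obtain B where B: "Ap_const u \<sigma> = ennreal B" "0 \<le> B" by (cases "Ap_const u \<sigma>") auto
  \<comment> \<open>This is the constant of \<open>Ap_wmass_le\<close> with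
    \<open>A = B + 1\<close>; the added 1 keeps \<open>d\<close> and \<open>C\<close> positive even
    if \<open>B = 0\<close>.\<close>
  define d where "d = (B + 1) / \<eta> powr u"
  have d: "0 < d" using B \<eta> by (simp add: d_def)
  define C where "C = d * (2 * (p / (p - 1))) powr p"
  have C: "0 < C" using d p by (simp add: C_def)
  have p': "1 / conj_exponent p + 1 / p = 1" "0 < 1 / conj_exponent p"
    using p by (auto simp: conj_exponent_def field_simps)
  have null: "wintegral \<sigma> S f = 0"
    if S: "S \<in> dyadic_cubes" and f: "locally_integrable f" and 0: "wmass \<sigma> S = 0" for S and f :: "real ^ 'd \<Rightarrow> real"
  proof -
    note [measurable] = locally_integrable_measurable[OF f]
    have [measurable]: "S \<in> sets lebesgue" using dyadic_cube_obtain[OF S] .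
    have "AE x in lebesgue. ennreal (\<sigma> x) * indicator S x = 0"
      using 0 unfolding wmass_def by (subst (asm) nn_integral_0_iff_AE) auto
    then have "AE x in lebesgue. ennreal (f x * \<sigma> x) * indicator S x = 0"
    proof eventually_elim
      case (elim x)
      then show ?case using \<sigma>0[of x] by (auto simp: ennreal_eq_0_iff)
    qed
    then show ?thesis
      unfolding wintegral_def by (subst nn_integral_0_iff_AE) auto
  qed
  have "index_bound \<eta> p \<sigma> (\<lambda>S. epowr (wmass \<sigma> S / emeasure lebesgue S) (1 / conj_exponent p)) C"
  proof (rule index_boundI[OF C], goal_cases)
    case (1 S f)
    have "wmass \<sigma> S = 0"
      using 1(4) p'(2) divide_dyadic_cube_eq_0_iff[OF 1(1)] by (simp only: epowr_eq_0_iff)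
    then show ?case using null 1 by simp
  next
    case (2 F f)
    note [measurable] = locally_integrable_measurable[OF 2(4)]
    have f0: "0 \<le> f x" for x by (rule 2)
    \<comment> \<open>In the measure \<open>\<sigma> dx\<close> the weighted norm of
      \<open>f\<close> becomes an unweighted one, and the sets \<open>E S\<close> can be kept
      unchanged.\<close>
    define M where "M = density lebesgue (\<lambda>x. ennreal (\<sigma> x))"
    have sets_M [simp]: "sets M = sets lebesgue" by (simp add: M_def)
    have Fd: "F \<subseteq> dyadic_cubes" using 2(2) by (simp add: sparse_family_def)
    obtain E where E: "\<And>S. S \<in> F \<Longrightarrow> E S \<in> sets lebesgue" "\<And>S. S \<in> F \<Longrightarrow> E S \<subseteq> S"
        "\<And>S. S \<in> F \<Longrightarrow> \<eta> * measure lebesgue S \<le> measure lebesgue (E S)" "disjoint_family_on E F"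
      using 2(2) by (auto simp: sparse_family_def)
    have em: "emeasure M S = wmass \<sigma> S" if "S \<in> sets lebesgue" for S
      using that by (simp add: M_def emeasure_density wmass_def)
    have S: "S \<in> sets lebesgue" "emeasure M S < \<infinity>" if S: "S \<in> F" for S
    proof -
      obtain Q where Q: "compact Q" "S \<subseteq> Q" "S \<in> sets lebesgue"
        using dyadic_cube_obtain S Fd by (metis subsetD)
      then show "S \<in> sets lebesgue" "emeasure M S < \<infinity>"
        using em wmass_mono[of S Q \<sigma>] wmass_finite[OF w, of Q] by (auto intro: le_less_trans)
    qed
    have ES: "measure M S \<le> d * measure M (E S)" if "S \<in> F" for S
    proof -
      have "emeasure M S \<le> ennreal d * emeasure M (E S)"
        using Ap_wmass_le[OF w u(1), of "B + 1" S "E S" \<eta>] B \<eta> E that Fd S em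
        by (auto simp: d_def ennreal_leI)
      moreover have "emeasure M (E S) < \<infinity>"
        using emeasure_mono[OF E(2), of S M] S that by (auto intro: le_less_trans)
      ultimately show ?thesis
        using S(2)[OF that] d
        by (simp add: emeasure_eq_ennreal_measure less_top ennreal_mult[symmetric])
    qed
    have int: "integrable M (\<lambda>x. f x powr p)" and
      N: "(\<integral>\<^sup>+x. ennreal (f x powr p * \<sigma> x) \<partial>lebesgue) = ennreal (LINT x|M. f x powr p)"
    proof -
      have eq: "(\<integral>\<^sup>+x. ennreal (f x powr p * \<sigma> x) \<partial>lebesgue) = (\<integral>\<^sup>+x. ennreal (f x powr p) \<partial>M)"
        unfolding M_def using \<sigma>0 by (subst nn_integral_density) (auto simp: ennreal_mult mult.commute)
      show int: "integrable M (\<lambda>x. f x powr p)"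
        using 2(5) unfolding eq by (intro integrableI_nonneg) (auto simp: M_def less_top)
      show "(\<integral>\<^sup>+x. ennreal (f x powr p * \<sigma> x) \<partial>lebesgue) = ennreal (LINT x|M. f x powr p)"
        unfolding eq using int by (intro nn_integral_eq_integral) auto
    qed
    define I where "I S = (LINT x:S|M. f x)" for S
    define m where "m S = measure M S" for S
    have fM: "f \<in> borel_measurable M" by (simp add: M_def)
    note emb = sparse_embedding[of F p f M E d, OF 2(1) laminar_subset[OF laminar_dyadic Fd] p f0 fM int]
    have emb1: "set_integrable M S f" if "S \<in> F" for S
      by (rule emb(1)) (use E S ES that in auto)
    have emb2: "(\<Sum>S\<in>F. m S * (I S / m S) powr p) \<le> C * (LINT x|M. f x powr p)"
      using emb(2) E S ES d by (auto simp: I_def m_def C_def)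
    have I0: "0 \<le> I S" for S using f0 by (simp add: I_def set_lebesgue_integral_def)
    have m0: "0 \<le> m S" for S by (simp add: m_def)
    have wint: "wintegral \<sigma> S f = ennreal (I S)" if "S \<in> F" for S
    proof -
      have [measurable]: "S \<in> sets lebesgue" using S that by simp
      have "wintegral \<sigma> S f = (\<integral>\<^sup>+x. ennreal (indicator S x *\<^sub>R f x) \<partial>M)"
        unfolding wintegral_def M_def using \<sigma>0 f0
        by (subst nn_integral_density) (auto intro!: nn_integral_cong simp: indicator_def ennreal_mult mult.commute)
      also have "\<dots> = ennreal (I S)"
        unfolding I_def set_lebesgue_integral_def using emb1[OF that] f0
        by (intro nn_integral_eq_integral) (auto simp: set_integrable_def)
      finally show ?thesis .
    qed
    \<comment> \<open>The \<open>p\<close>-th power is \<open>m S\<close> times the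
      \<open>p\<close>-th power of the \<open>\<sigma>\<close>-average of \<open>f\<close>, the term
      bounded in \<open>emb2\<close>.\<close>
    define a where "a S = ennreal (m S powr (1 / p) * (I S / m S))" for S
    have "wintegral \<sigma> S f \<le> ennreal (measure lebesgue S powr (1 / conj_exponent p)) *
        epowr (wmass \<sigma> S / emeasure lebesgue S) (1 / conj_exponent p) * a S" if SF: "S \<in> F" for S
    proof (cases "wmass \<sigma> S = 0")
      case True
      then show ?thesis using null[OF _ 2(4)] SF Fd by auto
    next
      case False
      define s where "s = measure lebesgue S"
      have s: "0 < s" "emeasure lebesgue S = ennreal s"
        using dyadic_cube_obtain[of S] Fd SF unfolding s_def by (metis subsetD)+
      have wm: "wmass \<sigma> S = ennreal (m S)"
        using S[OF SF] em[of S] emeasure_eq_ennreal_measure[of M S] by (simp add: m_def)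
      then have m: "0 < m S" using False m0[of S] by (simp add: ennreal_eq_0_iff)
      \<comment> \<open>The powers of the volume cancel, and the two exponents of the mass add up to
        1.\<close>
      have "s powr (1 / conj_exponent p) * (m S / s) powr (1 / conj_exponent p) * (m S powr (1 / p) * (I S / m S))
          = (m S powr (1 / conj_exponent p) * m S powr (1 / p)) * (I S / m S)"
        using s m by (simp add: powr_divide)
      also have "\<dots> = I S"
        using m by (simp add: p' flip: powr_add)
      finally show ?thesis
        unfolding wint[OF SF] wm s(2) a_def s_def[symmetric]
        using s(1) m I0[of S] p' by (simp add: divide_ennreal epowr_ennreal flip: ennreal_mult)
    qed
    moreover have "(\<Sum>S\<in>F. epowr (a S) p) \<le> ennreal C * (\<integral>\<^sup>+x. ennreal (f x powr p * \<sigma> x) \<partial>lebesgue)"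
    proof -
      have "epowr (a S) p = ennreal (m S * (I S / m S) powr p)" for S
        using I0[of S] m0[of S] p by (simp add: a_def epowr_ennreal' powr_mult powr_powr powr_divide)
      then have "(\<Sum>S\<in>F. epowr (a S) p) = ennreal (\<Sum>S\<in>F. m S * (I S / m S) powr p)"
        using m0 by simp
      also have "\<dots> \<le> ennreal (C * (LINT x|M. f x powr p))"
        using emb2 by (rule ennreal_leI)
      finally show ?thesis using C N by (simp add: ennreal_mult)
    qed
    ultimately show ?case by blast
  qed
  then show ?thesis using C by blast
qed

text \<open>Since \<open>\<theta> > 1\<close>, Hoelder's inequality leaves room: the average of \<open>f \<sigma>\<^sup>1\<^sup>/\<^sup>p\<close> that appears has an
  exponent \<open>p / r < p\<close>, so that the unweighted maximal operator is still bounded.\<close>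

lemma index_bound_bump:
  fixes \<sigma> :: "real ^ 'd \<Rightarrow> real"
  assumes w: "weight \<sigma>" and p: "1 < p" and \<eta>: "0 < \<eta>" and \<theta>: "1 < \<theta>"
  shows "\<exists>C>0. index_bound \<eta> p \<sigma>
           (\<lambda>S. epowr (wmass (\<lambda>x. \<sigma> x powr \<theta>) S / emeasure lebesgue S) (1 / (\<theta> * conj_exponent p))) C"
proof -
  note [measurable] = weight_measurable[OF w]
  have \<sigma>0: "0 \<le> \<sigma> x" for x using w by (simp add: weight_def)
  define \<beta> where "\<beta> = 1 / (\<theta> * conj_exponent p)"
  \<comment> \<open>The value of \<open>r\<close> is forced by \<open>\<alpha> + \<beta> = 1\<close>
    with \<open>\<alpha> = r / p\<close> and \<open>\<beta> = (p - 1) / (\<theta> * p)\<close>. It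
    exceeds 1 because \<open>\<theta> > 1\<close>.\<close>
  define r where "r = p - (p - 1) / \<theta>"
  define \<alpha> where "\<alpha> = r / p"
  have r: "1 < r"
  proof -
    have "(p - 1) / \<theta> < p - 1" using p \<theta> by (simp add: divide_less_eq)
    then show ?thesis by (simp add: r_def)
  qed
  have \<beta>: "0 < \<beta>" "\<theta> * \<beta> = 1 / conj_exponent p" and \<alpha>: "0 < \<alpha>" and ab: "\<alpha> + \<beta> = 1"
    using p \<theta> r by (auto simp: \<beta>_def \<alpha>_def r_def conj_exponent_def field_simps)
  have p': "1 / conj_exponent p + 1 / p = 1" "0 < 1 / conj_exponent p"
    using p by (auto simp: conj_exponent_def field_simps)
  define C where "C = 1 / \<eta> * (2 * (r / (r - 1))) powr r"
  have C: "0 < C" using \<eta> r by (simp add: C_def)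
  \<comment> \<open>Two identities dictate \<open>h\<close>: its \<open>r\<close>-th power is
    \<open>f powr p * \<sigma>\<close>, so the norm of \<open>f\<close> is recovered, and
    \<open>f * \<sigma>\<close> is \<open>h powr \<alpha>\<close> times
    \<open>(\<sigma> powr \<theta>) powr \<beta>\<close>, ready for Hoelder's inequality on a
    cube.\<close>
  define h where "h f x = f x powr (1 / \<alpha>) * \<sigma> x powr (1 / r)" for f :: "real ^ 'd \<Rightarrow> real" and x
  have h0: "0 \<le> h f x" for f x by (simp add: h_def)
  have hr: "h f x powr r = f x powr p * \<sigma> x" if "0 \<le> f x" for f x
    using p r \<alpha> \<sigma>0[of x] by (simp add: h_def powr_mult powr_powr \<alpha>_def)
  have holder: "wintegral \<sigma> S f \<le> epowr (\<integral>\<^sup>+x\<in>S. ennreal (h f x) \<partial>lebesgue) \<alpha> * epowr (wmass (\<lambda>x. \<sigma> x powr \<theta>) S) \<beta>"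
    if S: "S \<in> dyadic_cubes" and f: "\<And>x. 0 \<le> f x" "locally_integrable f" for S f
  proof -
    note [measurable] = locally_integrable_measurable[OF f(2)]
    have [measurable]: "S \<in> sets lebesgue" using dyadic_cube_obtain[OF S] .
    have eq: "f x * \<sigma> x = h f x powr \<alpha> * (\<sigma> x powr \<theta>) powr \<beta>" for x
    proof -
      have "h f x powr \<alpha> = f x * \<sigma> x powr (1 / p)"
        using \<alpha> f(1)[of x] r p by (simp add: h_def powr_mult powr_powr) (simp add: \<alpha>_def)
      then have "h f x powr \<alpha> * (\<sigma> x powr \<theta>) powr \<beta> = f x * (\<sigma> x powr (1 / p) * \<sigma> x powr (1 / conj_exponent p))"
        by (simp add: powr_powr \<beta>)
      also have "\<dots> = f x * \<sigma> x powr 1"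
        using p' by (simp add: add.commute flip: powr_add)
      finally show ?thesis using \<sigma>0[of x] by simp
    qed
    have "wintegral \<sigma> S f = (\<integral>\<^sup>+x. ennreal (h f x powr \<alpha> * (\<sigma> x powr \<theta>) powr \<beta>) \<partial>restrict_space lebesgue S)"
      by (simp add: wintegral_def eq nn_integral_restrict_space)
    also have "\<dots> \<le> epowr (\<integral>\<^sup>+x. ennreal (h f x) \<partial>restrict_space lebesgue S) \<alpha>
        * epowr (\<integral>\<^sup>+x. ennreal (\<sigma> x powr \<theta>) \<partial>restrict_space lebesgue S) \<beta>"
      using h0 \<alpha> \<beta>(1) ab by (intro nn_integral_Holder measurable_restrict_space1) (auto simp: h_def)
    finally show ?thesis by (simp add: nn_integral_restrict_space wmass_def)
  qed
  have "index_bound \<eta> p \<sigma> (\<lambda>S. epowr (wmass (\<lambda>x. \<sigma> x powr \<theta>) S / emeasure lebesgue S) \<beta>) C"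
  proof (rule index_boundI[OF C], goal_cases)
    case (1 S f)
    have "wmass (\<lambda>x. \<sigma> x powr \<theta>) S = 0"
      using 1(4) \<beta>(1) divide_dyadic_cube_eq_0_iff[OF 1(1)] by (simp only: epowr_eq_0_iff)
    then show ?case using holder[OF 1(1-3)] \<beta> by simp
  next
    case (2 F f)
    note [measurable] = locally_integrable_measurable[OF 2(4)]
    have f0: "0 \<le> f x" for x by (rule 2)
    have Fd: "F \<subseteq> dyadic_cubes" using 2(2) by (simp add: sparse_family_def)
    obtain E where E: "\<And>S. S \<in> F \<Longrightarrow> E S \<in> sets lebesgue" "\<And>S. S \<in> F \<Longrightarrow> E S \<subseteq> S"
        "\<And>S. S \<in> F \<Longrightarrow> \<eta> * measure lebesgue S \<le> measure lebesgue (E S)" "disjoint_family_on E F"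
      using 2(2) by (auto simp: sparse_family_def)
    define s where "s S = measure lebesgue S" for S :: "(real ^ 'd) set"
    have S: "S \<in> sets lebesgue" "0 < s S" "emeasure lebesgue S = ennreal (s S)" if "S \<in> F" for S
      using dyadic_cube_obtain[of S] Fd that unfolding s_def by (metis subsetD)+
    have ES: "measure lebesgue S \<le> 1 / \<eta> * measure lebesgue (E S)" if "S \<in> F" for S
      using E(3)[OF that] \<eta> by (simp add: field_simps)
    have int: "integrable lebesgue (\<lambda>x. h f x powr r)" and
      N: "(\<integral>\<^sup>+x. ennreal (f x powr p * \<sigma> x) \<partial>lebesgue) = ennreal (LINT x|lebesgue. h f x powr r)"
    proof -
      show int: "integrable lebesgue (\<lambda>x. h f x powr r)"
        using 2(5) \<sigma>0 by (intro integrableI_nonneg) (auto simp: hr[OF f0] less_top)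
      show "(\<integral>\<^sup>+x. ennreal (f x powr p * \<sigma> x) \<partial>lebesgue) = ennreal (LINT x|lebesgue. h f x powr r)"
        using nn_integral_eq_integral[OF int] \<sigma>0 by (simp add: hr[OF f0])
    qed
    define I where "I S = (LINT x:S|lebesgue. h f x)" for S
    have hM: "h f \<in> borel_measurable lebesgue" unfolding h_def by measurable
    note emb = sparse_embedding[of F r "h f" lebesgue E "1 / \<eta>", OF 2(1) laminar_subset[OF laminar_dyadic Fd] r h0 hM int]
    have emb1: "set_integrable lebesgue S (h f)" if "S \<in> F" for S
      by (rule emb(1)) (use E S ES that in auto)
    have emb2: "(\<Sum>S\<in>F. s S * (I S / s S) powr r) \<le> C * (LINT x|lebesgue. h f x powr r)"
    proof -
      have "(\<Sum>S\<in>F. s S * (I S / s S) powr r) \<le> \<bar>1 / \<eta>\<bar> * (2 * (r / (r - 1))) powr r * (LINT x|lebesgue. h f x powr r)"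
        unfolding I_def s_def by (rule emb(2)) (use E S ES in auto)
      then show ?thesis using \<eta> by (simp add: C_def)
    qed
    have I0: "0 \<le> I S" for S using h0 by (simp add: I_def set_lebesgue_integral_def)
    have s0: "0 \<le> s S" for S by (simp add: s_def)
    have hint: "(\<integral>\<^sup>+x\<in>S. ennreal (h f x) \<partial>lebesgue) = ennreal (I S)" if "S \<in> F" for S
    proof -
      have "(\<integral>\<^sup>+x\<in>S. ennreal (h f x) \<partial>lebesgue) = (\<integral>\<^sup>+x. ennreal (indicator S x *\<^sub>R h f x) \<partial>lebesgue)"
        by (intro nn_integral_cong) (simp add: indicator_def)
      also have "\<dots> = ennreal (I S)"
        unfolding I_def set_lebesgue_integral_def using emb1[OF that] h0
        by (intro nn_integral_eq_integral) (auto simp: set_integrable_def)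
      finally show ?thesis .
    qed
    \<comment> \<open>Since \<open>\<alpha> * p = r\<close>, the \<open>p\<close>-th power is
      \<open>s S\<close> times the \<open>r\<close>-th power of the average of \<open>h f\<close>,
      as in \<open>emb2\<close>.\<close>
    define a where "a S = ennreal (s S powr (1 / p) * (I S / s S) powr \<alpha>)" for S
    have "wintegral \<sigma> S f \<le> ennreal (measure lebesgue S powr (1 / conj_exponent p)) *
        epowr (wmass (\<lambda>x. \<sigma> x powr \<theta>) S / emeasure lebesgue S) \<beta> * a S" if SF: "S \<in> F" for S
    proof -
      \<comment> \<open>\<open>Z\<close> stays in \<open>ennreal\<close>, since
        \<open>\<sigma> powr \<theta>\<close> may fail to be integrable on \<open>S\<close>.\<close>
      define Z where "Z = wmass (\<lambda>x. \<sigma> x powr \<theta>) S / ennreal (s S)"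
      have s: "0 < s S" using S SF by simp
      have Z: "wmass (\<lambda>x. \<sigma> x powr \<theta>) S = ennreal (s S) * Z"
        using s unfolding Z_def ennreal_times_divide
        by (subst mult.commute) (simp add: mult_divide_eq_ennreal ennreal_eq_0_iff not_le)
      have "wintegral \<sigma> S f \<le> epowr (ennreal (I S)) \<alpha> * epowr (ennreal (s S) * Z) \<beta>"
        using holder[OF _ f0 2(4), of S] Fd SF hint[OF SF] Z by auto
      also have "\<dots> = ennreal (I S powr \<alpha> * s S powr \<beta>) * epowr Z \<beta>"
        using I0[of S] s \<alpha> \<beta> by (simp add: epowr_mult epowr_ennreal' ennreal_mult mult.assoc)
      also have "I S powr \<alpha> * s S powr \<beta> = s S powr (1 / conj_exponent p) * (s S powr (1 / p) * (I S / s S) powr \<alpha>)"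
      proof -
        have "s S powr (1 / conj_exponent p) * (s S powr (1 / p) * (I S / s S) powr \<alpha>)
            = I S powr \<alpha> * (s S powr (1 / conj_exponent p) * s S powr (1 / p) / s S powr \<alpha>)"
          using I0[of S] s by (simp add: powr_divide)
        also have "\<dots> = I S powr \<alpha> * s S powr (1 - \<alpha>)"
          using s by (simp only: powr_diff p' flip: powr_add)
        also have "1 - \<alpha> = \<beta>" using ab by simp
        finally show ?thesis by simp
      qed
      finally show ?thesis
        unfolding S(3)[OF SF] Z_def[symmetric] a_def s_def[symmetric]
        using s by (simp add: ennreal_mult mult_ac)
    qed
    moreover have "(\<Sum>S\<in>F. epowr (a S) p) \<le> ennreal C * (\<integral>\<^sup>+x. ennreal (f x powr p * \<sigma> x) \<partial>lebesgue)"
    proof -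
      have "\<alpha> * p = r" using p by (simp add: \<alpha>_def)
      then have "epowr (a S) p = ennreal (s S * (I S / s S) powr r)" for S
        using I0[of S] s0[of S] p by (simp add: a_def epowr_ennreal' powr_mult powr_powr)
      then have "(\<Sum>S\<in>F. epowr (a S) p) = ennreal (\<Sum>S\<in>F. s S * (I S / s S) powr r)"
        using s0 by simp
      also have "\<dots> \<le> ennreal (C * (LINT x|lebesgue. h f x powr r))"
        using emb2 by (rule ennreal_leI)
      finally show ?thesis using C N by (simp add: ennreal_mult)
    qed
    ultimately show ?case by blast
  qed
  then show ?thesis using C unfolding \<beta>_def by blast
qed

section \<open>From single indices to the multilinear inequality\<close>

lemma multilinear_embedding_of_index_bounds:
  fixes \<sigma> :: "nat \<Rightarrow> real ^ 'd \<Rightarrow> real" and K :: "(real ^ 'd) set \<Rightarrow> real"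
  assumes p: "\<And>i. i \<in> {1..n} \<Longrightarrow> 1 < p i" and sum: "1 \<le> (\<Sum>i=1..n. 1 / p i)"
    and C: "\<And>i. i \<in> {1..n} \<Longrightarrow> 0 < C i" "\<And>i. i \<in> {1..n} \<Longrightarrow> index_bound \<eta> (p i) (\<sigma> i) (T i) (C i)"
    and S: "sparse_family \<eta> \<S>"
  shows "multilinear_embedding n p \<sigma> K \<S> (ennreal (\<Prod>i=1..n. C i powr (1 / p i)) *
     (SUP S\<in>\<S>. ennreal (K S) * ennreal (measure lebesgue S powr (real n - (\<Sum>i=1..n. 1 / p i))) * (\<Prod>i=1..n. T i S)))"
    (is "multilinear_embedding n p \<sigma> K \<S> (_ * ?A)")
  unfolding multilinear_embedding_def
proof (intro allI impI)
  fix f :: "nat \<Rightarrow> real ^ 'd \<Rightarrow> real"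
  assume f: "\<forall>i\<in>{1..n}. (\<forall>x. 0 \<le> f i x) \<and> locally_integrable (f i)"
  let ?R = "ennreal (\<Prod>i=1..n. C i powr (1 / p i)) * ?A * (\<Prod>i=1..n. wLp_norm (p i) (\<sigma> i) (f i))"
  have "(\<Sum>S\<in>F. ennreal (K S) * (\<Prod>i=1..n. wintegral (\<sigma> i) S (f i))) \<le> ?R" if F: "finite F" "F \<subseteq> \<S>" for F
  proof -
    let ?N = "\<lambda>i. \<integral>\<^sup>+x. ennreal (\<bar>f i x\<bar> powr p i * \<sigma> i x) \<partial>lebesgue"
    \<comment> \<open>The numbers \<open>a i S\<close> may depend on the finite subfamily
      \<open>F\<close> and on \<open>f\<close>; only the constants \<open>C i\<close> are
      uniform.\<close>
    have "\<exists>a. \<forall>i\<in>{1..n}.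
        (\<forall>S\<in>F. wintegral (\<sigma> i) S (f i) \<le> ennreal (measure lebesgue S powr (1 / conj_exponent (p i))) * T i S * a i S) \<and>
        (\<Sum>S\<in>F. epowr (a i S) (p i)) \<le> ennreal (C i) * ?N i"
      using C(2) F(1) sparse_family_subset[OF S F(2)] f unfolding index_bound_def by (intro bchoice) blast
    then obtain a where
      a: "\<And>i S. i \<in> {1..n} \<Longrightarrow> S \<in> F \<Longrightarrow>
          wintegral (\<sigma> i) S (f i) \<le> ennreal (measure lebesgue S powr (1 / conj_exponent (p i))) * T i S * a i S"
        "\<And>i. i \<in> {1..n} \<Longrightarrow> (\<Sum>S\<in>F. epowr (a i S) (p i)) \<le> ennreal (C i) * ?N i"
      by blast
    have "ennreal (K S) * (\<Prod>i=1..n. wintegral (\<sigma> i) S (f i)) \<le> ?A * (\<Prod>i=1..n. a i S)" if SF: "S \<in> F" for S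
    proof -
      have "S \<in> dyadic_cubes" using SF F S by (auto simp: sparse_family_def)
      then have s: "measure lebesgue S \<noteq> 0" using dyadic_cube_obtain by (metis less_irrefl)
      \<comment> \<open>The volume exponents of the single indices add up to the exponent in the
        testing constant.\<close>
      have "(\<Sum>i=1..n. 1 / conj_exponent (p i)) = (\<Sum>i=1..n. 1 - 1 / p i)"
      proof (rule sum.cong)
        show "1 / conj_exponent (p i) = 1 - 1 / p i" if "i \<in> {1..n}" for i
          using p[OF that] by (simp add: conj_exponent_def field_simps)
      qed simp
      then have e: "(\<Sum>i=1..n. 1 / conj_exponent (p i)) = real n - (\<Sum>i=1..n. 1 / p i)"
        by (simp add: sum_subtractf)
      have "(\<Prod>i=1..n. wintegral (\<sigma> i) S (f i))
          \<le> (\<Prod>i=1..n. ennreal (measure lebesgue S powr (1 / conj_exponent (p i))) * T i S * a i S)"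
        using a(1) SF by (intro prod_mono_ennreal) auto
      also have "\<dots> = ennreal (\<Prod>i=1..n. measure lebesgue S powr (1 / conj_exponent (p i)))
          * (\<Prod>i=1..n. T i S) * (\<Prod>i=1..n. a i S)"
        by (simp add: prod.distrib prod_ennreal)
      also have "(\<Prod>i=1..n. measure lebesgue S powr (1 / conj_exponent (p i)))
          = measure lebesgue S powr (real n - (\<Sum>i=1..n. 1 / p i))"
        unfolding e[symmetric] using s by (rule powr_sum[symmetric])
      finally have "ennreal (K S) * (\<Prod>i=1..n. wintegral (\<sigma> i) S (f i)) \<le> ennreal (K S) *
          (ennreal (measure lebesgue S powr (real n - (\<Sum>i=1..n. 1 / p i))) * (\<Prod>i=1..n. T i S) * (\<Prod>i=1..n. a i S))"
        by (rule mult_left_mono) simp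
      also have "\<dots> = (ennreal (K S) * ennreal (measure lebesgue S powr (real n - (\<Sum>i=1..n. 1 / p i))) * (\<Prod>i=1..n. T i S))
          * (\<Prod>i=1..n. a i S)"
        by (simp add: mult.assoc)
      also have "\<dots> \<le> ?A * (\<Prod>i=1..n. a i S)"
        using SF F by (intro mult_right_mono SUP_upper) auto
      finally show ?thesis .
    qed
    then have "(\<Sum>S\<in>F. ennreal (K S) * (\<Prod>i=1..n. wintegral (\<sigma> i) S (f i))) \<le> (\<Sum>S\<in>F. ?A * (\<Prod>i=1..n. a i S))"
      by (rule sum_mono)
    also have "\<dots> = ?A * (\<Sum>S\<in>F. \<Prod>i=1..n. a i S)"
      by (simp add: sum_distrib_left)
    also have "\<dots> \<le> ?A * (\<Prod>i=1..n. epowr (\<Sum>S\<in>F. epowr (a i S) (p i)) (1 / p i))"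
      using p sum F(1) by (intro mult_left_mono sum_prod_Holder) auto
    also have "\<dots> \<le> ?A * (\<Prod>i=1..n. ennreal (C i powr (1 / p i)) * wLp_norm (p i) (\<sigma> i) (f i))"
    proof (intro mult_left_mono prod_mono_ennreal)
      fix i assume i: "i \<in> {1..n}"
      have pi: "0 < 1 / p i" using p[OF i] by simp
      have "epowr (\<Sum>S\<in>F. epowr (a i S) (p i)) (1 / p i) \<le> epowr (ennreal (C i) * ?N i) (1 / p i)"
        using pi a(2)[OF i] by (rule epowr_mono)
      also have "\<dots> = ennreal (C i powr (1 / p i)) * wLp_norm (p i) (\<sigma> i) (f i)"
        unfolding wLp_norm_def epowr_mult[OF pi] using C(1)[OF i] by (simp add: epowr_ennreal)
      finally show "epowr (\<Sum>S\<in>F. epowr (a i S) (p i)) (1 / p i)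
          \<le> ennreal (C i powr (1 / p i)) * wLp_norm (p i) (\<sigma> i) (f i)" .
    qed simp
    also have "\<dots> = ?R"
      by (simp add: prod.distrib prod_ennreal mult_ac)
    finally show ?thesis .
  qed
  then show "(\<Sum>\<^sub>\<infinity>S\<in>\<S>. ennreal (K S) * (\<Prod>i=1..n. wintegral (\<sigma> i) S (f i))) \<le> ?R"
    \<comment> \<open>In \<open>ennreal\<close> the infinite sum is the supremum of its finite
      partial sums.\<close>
    by (subst nonneg_infsum_complete) (auto intro!: SUP_least)
qed

theorem theorem1p1:
  fixes n :: nat and \<sigma> :: "nat \<Rightarrow> real ^ 'd \<Rightarrow> real" and p :: "nat \<Rightarrow> real" and \<eta> :: real
  assumes "n \<ge> 2"
    and "\<forall>i\<in>{1..n}. weight (\<sigma> i)"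
    and "0 < \<eta>" and "\<eta> < 1"
    and "\<forall>i\<in>{1..n}. 1 < p i"
    and "(\<Sum>i=1..n. 1 / p i) \<ge> 1"
  shows "((\<forall>i\<in>{1..n}. \<sigma> i \<in> A_infinity) \<longrightarrow>
          (\<exists>c::ennreal. c < \<infinity> \<and>
            (\<forall>K \<S>. (\<forall>Q\<in>dyadic_cubes. 0 \<le> K Q) \<and> sparse_family \<eta> \<S> \<and> testing_const n p \<sigma> K \<S> < \<infinity> \<longrightarrow>
               multilinear_embedding n p \<sigma> K \<S> (c * testing_const n p \<sigma> K \<S>))))
       \<and> (\<forall>\<theta>>1. \<exists>c::ennreal. c < \<infinity> \<and>
            (\<forall>K \<S>. (\<forall>Q\<in>dyadic_cubes. 0 \<le> K Q) \<and> sparse_family \<eta> \<S> \<and> bumped_testing_const \<theta> n p \<sigma> K \<S> < \<infinity> \<longrightarrow>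
               multilinear_embedding n p \<sigma> K \<S> (c * bumped_testing_const \<theta> n p \<sigma> K \<S>)))"
proof (intro conjI impI allI)
  assume "\<forall>i\<in>{1..n}. \<sigma> i \<in> A_infinity"
  then have "\<forall>i\<in>{1..n}. \<exists>C>0. index_bound \<eta> (p i) (\<sigma> i)
      (\<lambda>S. epowr (wmass (\<sigma> i) S / emeasure lebesgue S) (1 / conj_exponent (p i))) C"
    using assms by (intro ballI index_bound_A_infinity) auto
  \<comment> \<open>The constants \<open>C i\<close> are fixed before \<open>K\<close> and
    \<open>\<S>\<close>, since \<open>index_bound\<close> ranges over all finite sparse families.
    This gives the required independence of \<open>c\<close>.\<close>
  from bchoice[OF this] obtain C where "\<And>i. i \<in> {1..n} \<Longrightarrow> 0 < C i \<and> index_bound \<eta> (p i) (\<sigma> i)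
      (\<lambda>S. epowr (wmass (\<sigma> i) S / emeasure lebesgue S) (1 / conj_exponent (p i))) (C i)"
    by blast
  then show "\<exists>c::ennreal. c < \<infinity> \<and>
            (\<forall>K \<S>. (\<forall>Q\<in>dyadic_cubes. 0 \<le> K Q) \<and> sparse_family \<eta> \<S> \<and> testing_const n p \<sigma> K \<S> < \<infinity> \<longrightarrow>
               multilinear_embedding n p \<sigma> K \<S> (c * testing_const n p \<sigma> K \<S>))"
    unfolding testing_const_def using assms
    by (intro exI[of _ "ennreal (\<Prod>i=1..n. C i powr (1 / p i))"] conjI allI impI
        multilinear_embedding_of_index_bounds[where \<eta> = \<eta>]) auto
next
  fix \<theta> :: real assume "1 < \<theta>"
  then have "\<forall>i\<in>{1..n}. \<exists>C>0. index_bound \<eta> (p i) (\<sigma> i)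
      (\<lambda>S. epowr (wmass (\<lambda>x. \<sigma> i x powr \<theta>) S / emeasure lebesgue S) (1 / (\<theta> * conj_exponent (p i)))) C"
    using assms by (intro ballI index_bound_bump) auto
  from bchoice[OF this] obtain C where "\<And>i. i \<in> {1..n} \<Longrightarrow> 0 < C i \<and> index_bound \<eta> (p i) (\<sigma> i)
      (\<lambda>S. epowr (wmass (\<lambda>x. \<sigma> i x powr \<theta>) S / emeasure lebesgue S) (1 / (\<theta> * conj_exponent (p i)))) (C i)"
    by blast
  then show "\<exists>c::ennreal. c < \<infinity> \<and>
            (\<forall>K \<S>. (\<forall>Q\<in>dyadic_cubes. 0 \<le> K Q) \<and> sparse_family \<eta> \<S> \<and> bumped_testing_const \<theta> n p \<sigma> K \<S> < \<infinity> \<longrightarrow>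
               multilinear_embedding n p \<sigma> K \<S> (c * bumped_testing_const \<theta> n p \<sigma> K \<S>))"
    unfolding bumped_testing_const_def using assms
    by (intro exI[of _ "ennreal (\<Prod>i=1..n. C i powr (1 / p i))"] conjI allI impI
        multilinear_embedding_of_index_bounds[where \<eta> = \<eta>]) auto
qed

end
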